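(* Let $p$ and $k$ be positive integers, let $e_1,\dots,e_k$ be positive integers, and let $h_1,\dots,h_k\in\Lambda_p$ be polynomials in $T$ such that the coefficients of the highest and lowest degree terms of each $h_j$ are units in $\mathbb{Z}_p$ and any two of the $h_j$ are coprime, i.e. $(h_i)+(h_j)=\Lambda_p$ for $i\ne j$. Then the Alexander quandle $\Lambda_p/(h_1^{e_1}\cdots h_k^{e_k})$ is isomorphic as a quandle to $$\Lambda_p/(h_1^{e_1})\times\cdots\times\Lambda_p/(h_k^{e_k}),$$ and each factor is inductively described by Alexander extensions: for each $j$ and each integer $d_j$ with $2\le d_j\le e_j$ there is $\phi_j\in Z^2_{\rm TQ}\big(\Lambda_p/(h_j^{d_j-1});\,\Lambda_p/(h_j)\big)$ such that, as quandles, $$\Lambda_p/(h_j^{d_j})\;\cong\; AE\big(\Lambda_p/(h_j^{d_j-1}),\ \Lambda_p/(h_j),\ \phi_j\big).$$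
   Context: A quandle is a set $X$ with a binary operation $*$ such that (I) $a*a=a$; (II) for all $a,b$ there is a unique $c$ with $a=c*b$; (III) $(a*b)*c=(a*c)*(b*c)$. Let $\Lambda=\mathbb{Z}[T,T^{-1}]$ and, for a positive integer $p$, $\Lambda_p=\mathbb{Z}_p[T,T^{-1}]$ with $\mathbb{Z}_p=\mathbb{Z}/p\mathbb{Z}$. An Alexander quandle is a $\Lambda$-module $M$ with operation $a*b=Ta+(1-T)b$; each quotient $\Lambda_p/(h)$ is regarded as an Alexander quandle. Products of quandles carry the componentwise operation. For a quandle $X$ and a $\Lambda$-module $A$, $Z^2_{\rm TQ}(X;A)$ is the set of functions $\phi:X\times X\to A$ with $\phi(x,x)=0$ for all $x$ and $$T\phi(x_1,x_2)+\phi(x_1*x_2,x_3)=T\phi(x_1,x_3)+(1-T)\phi(x_2,x_3)+\phi(x_1*x_3,x_2*x_3)$$ for all $x_1,x_2,x_3\in X$. For such $\phi$, the Alexander extension $AE(X,A,\phi)$ is the quandle on the set $A\times X$ with $(a_1,x_1)*(a_2,x_2)=(a_1*a_2+\phi(x_1,x_2),\,x_1*x_2)$. *)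

theory Defs
  imports "HOL-Algebra.Algebra"
begin

section \<open>Laurent polynomials\<close>

text \<open>
  A Laurent polynomial over \<open>R\<close> is its coefficient function: \<open>f\<close> stands for
  \<open>\<Sum>n. f n T^n\<close>, with finitely many nonzero coefficients.
\<close>

definition laurent_supp :: "('a, 'm) ring_scheme \<Rightarrow> (int \<Rightarrow> 'a) \<Rightarrow> int set" where
  "laurent_supp R f = {n. f n \<noteq> \<zero>\<^bsub>R\<^esub>}"

definition laurent :: "('a, 'm) ring_scheme \<Rightarrow> (int \<Rightarrow> 'a) ring" where
  "laurent R =
    \<lparr>carrier = {f. (\<forall>n. f n \<in> carrier R) \<and> finite (laurent_supp R f)},
     monoid.mult = (\<lambda>f g n. \<Oplus>\<^bsub>R\<^esub>i\<in>laurent_supp R f. f i \<otimes>\<^bsub>R\<^esub> g (n - i)),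
     one = (\<lambda>n. if n = 0 then \<one>\<^bsub>R\<^esub> else \<zero>\<^bsub>R\<^esub>),
     ring.zero = (\<lambda>n. \<zero>\<^bsub>R\<^esub>),
     add = (\<lambda>f g n. f n \<oplus>\<^bsub>R\<^esub> g n)\<rparr>"

definition laurent_T :: "('a, 'm) ring_scheme \<Rightarrow> int \<Rightarrow> 'a" where
  "laurent_T R = (\<lambda>n. if n = 1 then \<one>\<^bsub>R\<^esub> else \<zero>\<^bsub>R\<^esub>)"

definition is_polynomial :: "('a, 'm) ring_scheme \<Rightarrow> (int \<Rightarrow> 'a) \<Rightarrow> bool" where
  "is_polynomial R f \<longleftrightarrow> f \<in> carrier (laurent R) \<and> (\<forall>n<0. f n = \<zero>\<^bsub>R\<^esub>)"

text \<open>
  The lowest and highest terms of \<open>f = c_m T^m + \<dots> + c_n T^n\<close> have unit coefficients.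
  Over a nontrivial ring \<open>m\<close> and \<open>n\<close> are necessarily the lowest and highest degree of \<open>f\<close>
  (see the lemma below), and \<open>f\<close> is nonzero. Over the zero ring \<open>\<int>/1\<int>\<close> the only \<open>f\<close> is 0,
  whose coefficients are units; this formulation keeps that degenerate case.
\<close>

definition unit_end_coeffs :: "('a, 'm) ring_scheme \<Rightarrow> (int \<Rightarrow> 'a) \<Rightarrow> bool" where
  "unit_end_coeffs R f \<longleftrightarrow>
     (\<exists>m n. m \<le> n \<and> f m \<in> Units R \<and> f n \<in> Units R \<and>
        (\<forall>i. i < m \<or> n < i \<longrightarrow> f i = \<zero>\<^bsub>R\<^esub>))"

lemma unit_end_coeffs_nontrivial:
  assumes R: "ring R" and nontriv: "\<one>\<^bsub>R\<^esub> \<noteq> \<zero>\<^bsub>R\<^esub>" and f: "f \<in> carrier (laurent R)"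
  shows "unit_end_coeffs R f \<longleftrightarrow>
    laurent_supp R f \<noteq> {} \<and>
    f (Min (laurent_supp R f)) \<in> Units R \<and> f (Max (laurent_supp R f)) \<in> Units R"
    (is "_ \<longleftrightarrow> ?rhs")
proof
  interpret ring R by fact
  let ?S = "laurent_supp R f"
  have fin: "finite ?S" using f by (simp add: laurent_def)
  have z: "\<zero>\<^bsub>R\<^esub> \<notin> Units R"
    using nontriv by (auto simp: Units_def)
  assume "unit_end_coeffs R f"
  then obtain m n where mn: "m \<le> n" "f m \<in> Units R" "f n \<in> Units R"
    "\<And>i. i < m \<or> n < i \<Longrightarrow> f i = \<zero>\<^bsub>R\<^esub>"
    unfolding unit_end_coeffs_def by blast
  have m: "m \<in> ?S" and n: "n \<in> ?S"
    using mn z by (auto simp: laurent_supp_def)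
  have bnd: "m \<le> i \<and> i \<le> n" if "i \<in> ?S" for i
    using that mn(4)[of i] by (force simp: laurent_supp_def)
  have "Min ?S = m" by (rule Min_eqI) (use fin m bnd in auto)
  moreover have "Max ?S = n" by (rule Max_eqI) (use fin n bnd in auto)
  ultimately show ?rhs using mn m by auto
next
  let ?S = "laurent_supp R f"
  have fin: "finite ?S" using f by (simp add: laurent_def)
  assume r: ?rhs
  have "f i = \<zero>\<^bsub>R\<^esub>" if "i < Min ?S \<or> Max ?S < i" for i
  proof (rule ccontr)
    assume "f i \<noteq> \<zero>\<^bsub>R\<^esub>"
    then have "i \<in> ?S" by (simp add: laurent_supp_def)
    then have "Min ?S \<le> i" "i \<le> Max ?S" using fin by auto
    with that show False by linarith
  qed
  moreover have "Min ?S \<le> Max ?S"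
    using fin r by (meson Max_ge Min_in)
  ultimately show "unit_end_coeffs R f"
    unfolding unit_end_coeffs_def using r by blast
qed

abbreviation Lam :: "(int \<Rightarrow> int) ring" (\<open>\<Lambda>\<close>) where
  "\<Lambda> \<equiv> laurent \<Z>"

definition Lam_mod :: "nat \<Rightarrow> (int \<Rightarrow> int set) ring" where
  "Lam_mod p = laurent (ZFact (int p))"

text \<open>Coefficientwise reduction \<open>\<Lambda> \<rightarrow> \<Lambda>_p\<close>.\<close>

definition Lam_reduce :: "nat \<Rightarrow> (int \<Rightarrow> int) \<Rightarrow> int \<Rightarrow> int set" where
  "Lam_reduce p f = (\<lambda>n. Idl\<^bsub>\<Z>\<^esub> {int p} +>\<^bsub>\<Z>\<^esub> f n)"

text \<open>
  \<open>\<Lambda>_p/(h)\<close> as a \<open>\<Lambda>\<close>-module: the quotient ring, with scalars acting through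
  \<open>\<Lambda> \<rightarrow> \<Lambda>_p \<rightarrow> \<Lambda>_p/(h)\<close>.
\<close>

definition Lam_quot ::
  "nat \<Rightarrow> (int \<Rightarrow> int set) \<Rightarrow> (int \<Rightarrow> int, (int \<Rightarrow> int set) set) module" where
  "Lam_quot p h =
    (let Q = Lam_mod p Quot (PIdl\<^bsub>Lam_mod p\<^esub> h) in
      \<lparr>carrier = carrier Q, monoid.mult = monoid.mult Q, one = one Q, ring.zero = ring.zero Q, add = add Q,
       smult = (\<lambda>f a. (PIdl\<^bsub>Lam_mod p\<^esub> h +>\<^bsub>Lam_mod p\<^esub> Lam_reduce p f) \<otimes>\<^bsub>Q\<^esub> a)\<rparr>)"

section \<open>Quandles\<close>

record 'a quandle = "'a partial_object" +
  qop :: "['a, 'a] \<Rightarrow> 'a" (infixl \<open>\<star>\<index>\<close> 70)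

locale quandle =
  fixes Q (structure)
  assumes closed: "\<lbrakk>a \<in> carrier Q; b \<in> carrier Q\<rbrakk> \<Longrightarrow> a \<star> b \<in> carrier Q"
    and idem: "a \<in> carrier Q \<Longrightarrow> a \<star> a = a"
    and right_div: "\<lbrakk>a \<in> carrier Q; b \<in> carrier Q\<rbrakk> \<Longrightarrow> \<exists>!c. c \<in> carrier Q \<and> a = c \<star> b"
    and right_distrib: "\<lbrakk>a \<in> carrier Q; b \<in> carrier Q; c \<in> carrier Q\<rbrakk> \<Longrightarrow>
      (a \<star> b) \<star> c = (a \<star> c) \<star> (b \<star> c)"

definition quandle_iso :: "('a, 'm) quandle_scheme \<Rightarrow> ('b, 'n) quandle_scheme \<Rightarrow> ('a \<Rightarrow> 'b) set" where
  "quandle_iso Q Q' =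
    {f. bij_betw f (carrier Q) (carrier Q') \<and>
        (\<forall>a\<in>carrier Q. \<forall>b\<in>carrier Q. f (a \<star>\<^bsub>Q\<^esub> b) = f a \<star>\<^bsub>Q'\<^esub> f b)}"

text \<open>Unlike group isomorphism in the library, this includes that both sides are quandles.\<close>

definition quandle_isomorphic ::
  "('a, 'm) quandle_scheme \<Rightarrow> ('b, 'n) quandle_scheme \<Rightarrow> bool" (infixr \<open>\<cong>\<^sub>Q\<close> 60) where
  "Q \<cong>\<^sub>Q Q' \<longleftrightarrow> quandle Q \<and> quandle Q' \<and> quandle_iso Q Q' \<noteq> {}"

definition quandle_prod :: "'i set \<Rightarrow> ('i \<Rightarrow> ('a, 'm) quandle_scheme) \<Rightarrow> ('i \<Rightarrow> 'a) quandle" where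
  "quandle_prod I Q =
    \<lparr>carrier = (\<Pi>\<^sub>E i\<in>I. carrier (Q i)),
     qop = (\<lambda>a b. \<lambda>i\<in>I. a i \<star>\<^bsub>Q i\<^esub> b i)\<rparr>"

abbreviation T_smult :: "(int \<Rightarrow> int, 'b, 'm) module_scheme \<Rightarrow> 'b \<Rightarrow> 'b" where
  "T_smult M a \<equiv> laurent_T \<Z> \<odot>\<^bsub>M\<^esub> a"

abbreviation one_minus_T_smult :: "(int \<Rightarrow> int, 'b, 'm) module_scheme \<Rightarrow> 'b \<Rightarrow> 'b" where
  "one_minus_T_smult M a \<equiv> (\<one>\<^bsub>\<Lambda>\<^esub> \<ominus>\<^bsub>\<Lambda>\<^esub> laurent_T \<Z>) \<odot>\<^bsub>M\<^esub> a"

definition alexander_quandle :: "(int \<Rightarrow> int, 'b, 'm) module_scheme \<Rightarrow> 'b quandle" where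
  "alexander_quandle M =
    \<lparr>carrier = carrier M,
     qop = (\<lambda>a b. T_smult M a \<oplus>\<^bsub>M\<^esub> one_minus_T_smult M b)\<rparr>"

text \<open>\<open>Z_TQ2 Q A\<close> is \<open>Z^2_TQ(Q; A)\<close>, with cocycles curried.\<close>

definition Z_TQ2 ::
  "('x, 'n) quandle_scheme \<Rightarrow> (int \<Rightarrow> int, 'b, 'm) module_scheme \<Rightarrow> ('x \<Rightarrow> 'x \<Rightarrow> 'b) set" where
  "Z_TQ2 Q A =
    {\<phi>. \<phi> \<in> carrier Q \<rightarrow> carrier Q \<rightarrow> carrier A \<and>
        (\<forall>x\<in>carrier Q. \<phi> x x = \<zero>\<^bsub>A\<^esub>) \<and>
        (\<forall>x1\<in>carrier Q. \<forall>x2\<in>carrier Q. \<forall>x3\<in>carrier Q.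
           T_smult A (\<phi> x1 x2) \<oplus>\<^bsub>A\<^esub> \<phi> (x1 \<star>\<^bsub>Q\<^esub> x2) x3 =
           T_smult A (\<phi> x1 x3) \<oplus>\<^bsub>A\<^esub> one_minus_T_smult A (\<phi> x2 x3)
             \<oplus>\<^bsub>A\<^esub> \<phi> (x1 \<star>\<^bsub>Q\<^esub> x3) (x2 \<star>\<^bsub>Q\<^esub> x3))}"

definition alexander_extension ::
  "('x, 'n) quandle_scheme \<Rightarrow> (int \<Rightarrow> int, 'b, 'm) module_scheme \<Rightarrow> ('x \<Rightarrow> 'x \<Rightarrow> 'b)
    \<Rightarrow> ('b \<times> 'x) quandle" where
  "alexander_extension Q A \<phi> =
    \<lparr>carrier = carrier A \<times> carrier Q,
     qop = (\<lambda>(a1, x1) (a2, x2).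
       ((a1 \<star>\<^bsub>alexander_quandle A\<^esub> a2) \<oplus>\<^bsub>A\<^esub> \<phi> x1 x2, x1 \<star>\<^bsub>Q\<^esub> x2))\<rparr>"

end

theory Submission
  imports Defs "Jordan_Normal_Form.Missing_Ring"
begin

text \<open>
  Everything takes place in a commutative ring \<open>R\<close> with a distinguished unit \<open>t\<close>, the image of
  \<open>T\<close>; here \<open>R = \<Lambda>\<^sub>p\<close>. The operation \<open>x \<triangleright> y = t x + (1 - t) y\<close> of \<open>R\<close> descends to each quotient
  \<open>R/I\<close>, and a surjection from \<open>R\<close> to a set with a binary operation that respects the operations
  and identifies exactly the elements congruent modulo \<open>I\<close> induces an isomorphism from the
  Alexander quandle of \<open>R/I\<close> (\<open>alexander_quot_isomorphic\<close>). Both halves of the theorem come from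
  a suitable map on \<open>R\<close>.

  For the product decomposition the map takes \<open>x\<close> to its residues modulo the pairwise comaximal
  elements \<open>h\<^sub>j\<^bsup>e\<^sub>j\<^esup>\<close>; that it is surjective with kernel generated by their product is the Chinese
  remainder theorem (\<open>alexander_quot_finprod_isomorphic\<close>).

  For the extensions, let \<open>g\<close> be a non-zero-divisor and \<open>h\<close> any element, and choose a section \<open>s\<close>
  of \<open>R \<rightarrow> R/(g)\<close>. The defect \<open>s(x) \<triangleright> s(y) - s(x * y)\<close> is divisible by \<open>g\<close>, and its quotient
  \<open>c(x, y)\<close> satisfies the cocycle identity already in \<open>R\<close>, since after multiplication by \<open>g\<close> the
  identity telescopes to the self-distributivity of \<open>\<triangleright>\<close>. Every \<open>y \<in> R\<close> is uniquely \<open>g a + s(y mod g)\<close>,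
  and \<open>y \<mapsto> (a mod h, y mod g)\<close> induces an isomorphism from \<open>R/(gh)\<close> to the extension of \<open>R/(g)\<close> by
  \<open>R/(h)\<close> along \<open>c mod h\<close> (\<open>alexander_quot_mult_isomorphic\<close>). It is applied with
  \<open>g = h\<^sub>j\<^bsup>d - 1\<^esup>\<close> and \<open>h = h\<^sub>j\<close>; powers of \<open>h\<^sub>j\<close> are not zero divisors because the top
  coefficient of \<open>h\<^sub>j\<close> is a unit (\<open>unit_end_coeffs_cancel\<close>).
\<close>

section \<open>The ring of Laurent polynomials\<close>

lemma laurent_carrierD:
  assumes "f \<in> carrier (laurent R)"
  shows "f n \<in> carrier R" "finite (laurent_supp R f)"
  using assms by (auto simp: laurent_def)

lemma laurent_add [simp]: "f \<oplus>\<^bsub>laurent R\<^esub> g = (\<lambda>n. f n \<oplus>\<^bsub>R\<^esub> g n)"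
  by (simp add: laurent_def)

lemma laurent_zero [simp]: "\<zero>\<^bsub>laurent R\<^esub> = (\<lambda>n. \<zero>\<^bsub>R\<^esub>)"
  by (simp add: laurent_def)

lemma laurent_one: "\<one>\<^bsub>laurent R\<^esub> = (\<lambda>n. if n = 0 then \<one>\<^bsub>R\<^esub> else \<zero>\<^bsub>R\<^esub>)"
  by (simp add: laurent_def)

context ring
begin

lemma laurent_carrierI:
  assumes "\<And>n. f n \<in> carrier R" "finite A" "\<And>n. n \<notin> A \<Longrightarrow> f n = \<zero>"
  shows "f \<in> carrier (laurent R)"
proof -
  have "laurent_supp R f \<subseteq> A"
    using assms(3) by (auto simp: laurent_supp_def)
  then show ?thesis
    using assms(1,2) finite_subset by (auto simp: laurent_def)
qed

text \<open>
  The sum defining a coefficient of a product may be taken over any finite set of exponents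
  containing the support of the left factor.
\<close>

lemma laurent_mult_eq:
  assumes f: "f \<in> carrier (laurent R)" and g: "g \<in> carrier (laurent R)"
    and A: "finite A" "laurent_supp R f \<subseteq> A"
  shows "(f \<otimes>\<^bsub>laurent R\<^esub> g) n = (\<Oplus>i\<in>A. f i \<otimes> g (n - i))"
proof -
  have "(\<Oplus>i\<in>laurent_supp R f. f i \<otimes> g (n - i)) = (\<Oplus>i\<in>A. f i \<otimes> g (n - i))"
    by (rule add.finprod_mono_neutral_cong_left)
      (use A laurent_carrierD[OF f] laurent_carrierD[OF g] in \<open>auto simp: laurent_supp_def\<close>)
  then show ?thesis
    by (simp add: laurent_def)
qed

lemma laurent_mult_closed:
  assumes f: "f \<in> carrier (laurent R)" and g: "g \<in> carrier (laurent R)"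
  shows "f \<otimes>\<^bsub>laurent R\<^esub> g \<in> carrier (laurent R)"
    and "laurent_supp R (f \<otimes>\<^bsub>laurent R\<^esub> g) \<subseteq>
      (\<lambda>(i, j). i + j) ` (laurent_supp R f \<times> laurent_supp R g)" (is "_ \<subseteq> ?C")
proof -
  note cl = laurent_carrierD[OF f] laurent_carrierD[OF g]
  have eq: "(f \<otimes>\<^bsub>laurent R\<^esub> g) n = (\<Oplus>i\<in>laurent_supp R f. f i \<otimes> g (n - i))" for n
    by (simp add: laurent_def)
  have zero: "(f \<otimes>\<^bsub>laurent R\<^esub> g) n = \<zero>" if "n \<notin> ?C" for n
    unfolding eq
  proof (rule add.finprod_one_eqI)
    fix i assume i: "i \<in> laurent_supp R f"
    have "n - i \<notin> laurent_supp R g"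
      using that i by (force simp: image_iff)
    then show "f i \<otimes> g (n - i) = \<zero>"
      using cl by (simp add: laurent_supp_def)
  qed
  show "f \<otimes>\<^bsub>laurent R\<^esub> g \<in> carrier (laurent R)"
    by (rule laurent_carrierI[where A = ?C]) (use zero cl in \<open>auto simp: eq\<close>)
  show "laurent_supp R (f \<otimes>\<^bsub>laurent R\<^esub> g) \<subseteq> ?C"
    using zero by (auto simp: laurent_supp_def)
qed

lemma laurent_mult_assoc:
  assumes f: "f \<in> carrier (laurent R)" and g: "g \<in> carrier (laurent R)"
    and h: "h \<in> carrier (laurent R)"
  shows "f \<otimes>\<^bsub>laurent R\<^esub> g \<otimes>\<^bsub>laurent R\<^esub> h = f \<otimes>\<^bsub>laurent R\<^esub> (g \<otimes>\<^bsub>laurent R\<^esub> h)"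
proof
  fix n
  let ?A = "laurent_supp R f" and ?B = "laurent_supp R g"
  let ?C = "(\<lambda>(i, j). i + j) ` (?A \<times> ?B)"
  note cl [simp] = laurent_carrierD[OF f] laurent_carrierD[OF g] laurent_carrierD[OF h]
  have inner: "(g \<otimes>\<^bsub>laurent R\<^esub> h) (n - j) = (\<Oplus>i\<in>?C. g (i - j) \<otimes> h (n - i))"
    if j: "j \<in> ?A" for j
  proof -
    have sub: "?B \<subseteq> (\<lambda>i. i - j) ` ?C"
    proof
      fix k assume "k \<in> ?B"
      then have "j + k \<in> ?C" using j by force
      then show "k \<in> (\<lambda>i. i - j) ` ?C" by (intro image_eqI[where x = "j + k"]) auto
    qed
    have "(g \<otimes>\<^bsub>laurent R\<^esub> h) (n - j) = (\<Oplus>k\<in>(\<lambda>i. i - j) ` ?C. g k \<otimes> h (n - j - k))"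
      by (rule laurent_mult_eq[OF g h _ sub]) simp
    also have "\<dots> = (\<Oplus>i\<in>?C. g (i - j) \<otimes> h (n - j - (i - j)))"
      by (rule finsum_reindex) (auto simp: inj_on_def)
    finally show ?thesis by simp
  qed
  have "(f \<otimes>\<^bsub>laurent R\<^esub> g \<otimes>\<^bsub>laurent R\<^esub> h) n = (\<Oplus>i\<in>?C. (f \<otimes>\<^bsub>laurent R\<^esub> g) i \<otimes> h (n - i))"
    by (rule laurent_mult_eq[OF laurent_mult_closed(1)[OF f g] h _ laurent_mult_closed(2)[OF f g]])
      simp
  also have "\<dots> = (\<Oplus>i\<in>?C. \<Oplus>j\<in>?A. f j \<otimes> (g (i - j) \<otimes> h (n - i)))"
    by (rule finsum_cong')
      (auto simp: laurent_mult_eq[OF f g _ order_refl] finsum_ldistr m_assoc intro!: finsum_cong')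
  also have "\<dots> = (\<Oplus>j\<in>?A. \<Oplus>i\<in>?C. f j \<otimes> (g (i - j) \<otimes> h (n - i)))"
    by (rule finsum_finsum_swap) auto
  also have "\<dots> = (\<Oplus>j\<in>?A. f j \<otimes> (g \<otimes>\<^bsub>laurent R\<^esub> h) (n - j))"
    by (rule finsum_cong') (auto simp: inner finsum_rdistr)
  also have "\<dots> = (f \<otimes>\<^bsub>laurent R\<^esub> (g \<otimes>\<^bsub>laurent R\<^esub> h)) n"
    by (rule laurent_mult_eq[symmetric]) (use laurent_mult_closed[OF g h] f in auto)
  finally show "(f \<otimes>\<^bsub>laurent R\<^esub> g \<otimes>\<^bsub>laurent R\<^esub> h) n = (f \<otimes>\<^bsub>laurent R\<^esub> (g \<otimes>\<^bsub>laurent R\<^esub> h)) n" .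
qed

lemma laurent_monom_closed:
  "a \<in> carrier R \<Longrightarrow> (\<lambda>n. if n = m then a else \<zero>) \<in> carrier (laurent R)"
  by (rule laurent_carrierI[where A = "{m}"]) auto

lemma laurent_monom_mult:
  assumes a: "a \<in> carrier R" and f: "f \<in> carrier (laurent R)"
  shows "(\<lambda>n. if n = m then a else \<zero>) \<otimes>\<^bsub>laurent R\<^esub> f = (\<lambda>n. a \<otimes> f (n - m))"
proof
  fix n
  have "((\<lambda>n. if n = m then a else \<zero>) \<otimes>\<^bsub>laurent R\<^esub> f) n
      = (\<Oplus>i\<in>{m}. (if i = m then a else \<zero>) \<otimes> f (n - i))"
    by (rule laurent_mult_eq[OF laurent_monom_closed[OF a] f]) (auto simp: laurent_supp_def)
  then show "((\<lambda>n. if n = m then a else \<zero>) \<otimes>\<^bsub>laurent R\<^esub> f) n = a \<otimes> f (n - m)"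
    using a laurent_carrierD(1)[OF f] by simp
qed

lemma laurent_abelian_group: "abelian_group (laurent R)"
proof (rule abelian_groupI)
  fix f g assume f: "f \<in> carrier (laurent R)" and g: "g \<in> carrier (laurent R)"
  show "f \<oplus>\<^bsub>laurent R\<^esub> g \<in> carrier (laurent R)"
    by (rule laurent_carrierI[where A = "laurent_supp R f \<union> laurent_supp R g"])
      (use laurent_carrierD[OF f] laurent_carrierD[OF g] in \<open>auto simp: laurent_supp_def\<close>)
  show "f \<oplus>\<^bsub>laurent R\<^esub> g = g \<oplus>\<^bsub>laurent R\<^esub> f"
    using laurent_carrierD[OF f] laurent_carrierD[OF g] by (auto simp: a_comm)
next
  fix f assume f: "f \<in> carrier (laurent R)"
  show "\<exists>g\<in>carrier (laurent R). g \<oplus>\<^bsub>laurent R\<^esub> f = \<zero>\<^bsub>laurent R\<^esub>"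
  proof
    show "(\<lambda>n. \<ominus> f n) \<in> carrier (laurent R)"
      by (rule laurent_carrierI[where A = "laurent_supp R f"])
        (use laurent_carrierD[OF f] in \<open>auto simp: laurent_supp_def\<close>)
  qed (use laurent_carrierD[OF f] in \<open>auto simp: l_neg\<close>)
qed (auto simp: a_assoc laurent_carrierD(1) intro: laurent_carrierI[where A = "{}"])

end

text \<open>
  Reflecting \<open>i \<mapsto> n - i\<close> turns one convolution sum into the other, once the range of summation
  is large enough for both.
\<close>

lemma (in cring) laurent_mult_comm:
  assumes f: "f \<in> carrier (laurent R)" and g: "g \<in> carrier (laurent R)"
  shows "f \<otimes>\<^bsub>laurent R\<^esub> g = g \<otimes>\<^bsub>laurent R\<^esub> f"
proof
  fix n
  note cl [simp] = laurent_carrierD[OF f] laurent_carrierD[OF g]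
  let ?A = "laurent_supp R f \<union> (\<lambda>j. n - j) ` laurent_supp R g"
  have sub: "laurent_supp R g \<subseteq> (\<lambda>i. n - i) ` ?A"
    by (auto simp: image_Un image_image)
  have "(f \<otimes>\<^bsub>laurent R\<^esub> g) n = (\<Oplus>i\<in>?A. f i \<otimes> g (n - i))"
    by (rule laurent_mult_eq[OF f g]) auto
  also have "\<dots> = (\<Oplus>i\<in>?A. g (n - i) \<otimes> f (n - (n - i)))"
    by (rule finsum_cong') (auto simp: m_comm)
  also have "\<dots> = (\<Oplus>j\<in>(\<lambda>i. n - i) ` ?A. g j \<otimes> f (n - j))"
    by (rule finsum_reindex[symmetric]) (auto simp: inj_on_def)
  also have "\<dots> = (g \<otimes>\<^bsub>laurent R\<^esub> f) n"
    by (rule laurent_mult_eq[OF g f _ sub, symmetric]) simp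
  finally show "(f \<otimes>\<^bsub>laurent R\<^esub> g) n = (g \<otimes>\<^bsub>laurent R\<^esub> f) n" .
qed

lemma (in cring) laurent_cring: "cring (laurent R)"
proof (rule cringI)
  show "abelian_group (laurent R)"
    by (rule laurent_abelian_group)
  show "comm_monoid (laurent R)"
  proof (rule comm_monoidI)
    show "\<one>\<^bsub>laurent R\<^esub> \<in> carrier (laurent R)"
      unfolding laurent_one by (rule laurent_monom_closed) simp
    show "\<one>\<^bsub>laurent R\<^esub> \<otimes>\<^bsub>laurent R\<^esub> f = f" if "f \<in> carrier (laurent R)" for f
      using that laurent_carrierD[OF that] unfolding laurent_one
      by (simp add: laurent_monom_mult)
  qed (auto intro: laurent_mult_closed laurent_mult_assoc laurent_mult_comm)
  fix f g h
  assume f: "f \<in> carrier (laurent R)" and g: "g \<in> carrier (laurent R)"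
    and h: "h \<in> carrier (laurent R)"
  let ?A = "laurent_supp R f \<union> laurent_supp R g"
  note cl [simp] = laurent_carrierD[OF f] laurent_carrierD[OF g] laurent_carrierD[OF h]
  have fg: "f \<oplus>\<^bsub>laurent R\<^esub> g \<in> carrier (laurent R)"
    using abelian_monoid.a_closed[OF abelian_group.axioms(1)[OF laurent_abelian_group] f g] .
  show "(f \<oplus>\<^bsub>laurent R\<^esub> g) \<otimes>\<^bsub>laurent R\<^esub> h =
    f \<otimes>\<^bsub>laurent R\<^esub> h \<oplus>\<^bsub>laurent R\<^esub> g \<otimes>\<^bsub>laurent R\<^esub> h"
  proof
    fix n
    have "((f \<oplus>\<^bsub>laurent R\<^esub> g) \<otimes>\<^bsub>laurent R\<^esub> h) n
        = (\<Oplus>i\<in>?A. (f \<oplus>\<^bsub>laurent R\<^esub> g) i \<otimes> h (n - i))"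
      by (rule laurent_mult_eq[OF fg h], simp) (auto simp: laurent_supp_def)
    also have "\<dots> = (\<Oplus>i\<in>?A. f i \<otimes> h (n - i) \<oplus> g i \<otimes> h (n - i))"
      by (rule finsum_cong') (auto simp: l_distr)
    also have "\<dots> = (\<Oplus>i\<in>?A. f i \<otimes> h (n - i)) \<oplus> (\<Oplus>i\<in>?A. g i \<otimes> h (n - i))"
      by (rule finsum_addf) auto
    also have "\<dots> = (f \<otimes>\<^bsub>laurent R\<^esub> h) n \<oplus> (g \<otimes>\<^bsub>laurent R\<^esub> h) n"
      by (simp add: laurent_mult_eq[OF f h, of ?A] laurent_mult_eq[OF g h, of ?A])
    finally show "((f \<oplus>\<^bsub>laurent R\<^esub> g) \<otimes>\<^bsub>laurent R\<^esub> h) n =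
      (f \<otimes>\<^bsub>laurent R\<^esub> h \<oplus>\<^bsub>laurent R\<^esub> g \<otimes>\<^bsub>laurent R\<^esub> h) n" by simp
  qed
qed

lemma (in ring) laurent_a_inv:
  assumes f: "f \<in> carrier (laurent R)"
  shows "\<ominus>\<^bsub>laurent R\<^esub> f = (\<lambda>n. \<ominus> f n)"
proof (rule abelian_group.minus_equality[OF laurent_abelian_group])
  show "(\<lambda>n. \<ominus> f n) \<in> carrier (laurent R)"
    by (rule laurent_carrierI[where A = "laurent_supp R f"])
      (use laurent_carrierD[OF f] in \<open>auto simp: laurent_supp_def\<close>)
qed (use f laurent_carrierD[OF f] in \<open>auto simp: l_neg\<close>)

lemma (in ring) laurent_T_closed: "laurent_T R \<in> carrier (laurent R)"
  unfolding laurent_T_def by (rule laurent_monom_closed) simp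

lemma (in cring) laurent_T_unit: "laurent_T R \<in> Units (laurent R)"
proof -
  interpret L: cring "laurent R" by (rule laurent_cring)
  let ?S = "\<lambda>n. if n = - 1 then \<one> else \<zero>"
  have S: "?S \<in> carrier (laurent R)"
    by (rule laurent_monom_closed) simp
  have "laurent_T R \<otimes>\<^bsub>laurent R\<^esub> ?S = \<one>\<^bsub>laurent R\<^esub>"
    unfolding laurent_T_def by (subst laurent_monom_mult) (auto simp: S laurent_one)
  then show ?thesis
    using S laurent_T_closed L.m_comm[OF S laurent_T_closed] by (auto simp: Units_def)
qed

text \<open>
  An element whose top coefficient is a unit is not a zero divisor: compare coefficients in
  degree \<open>m + n\<close>, where \<open>m\<close> and \<open>n\<close> are the top degrees of \<open>h\<close> and \<open>x\<close>.
\<close>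

lemma (in cring) unit_end_coeffs_cancel:
  assumes h: "h \<in> carrier (laurent R)" and lead: "unit_end_coeffs R h"
    and x: "x \<in> carrier (laurent R)" and eq: "h \<otimes>\<^bsub>laurent R\<^esub> x = \<zero>\<^bsub>laurent R\<^esub>"
  shows "x = \<zero>\<^bsub>laurent R\<^esub>"
proof (rule ccontr)
  assume "x \<noteq> \<zero>\<^bsub>laurent R\<^esub>"
  note cl [simp] = laurent_carrierD[OF h] laurent_carrierD[OF x]
  obtain m where m: "h m \<in> Units R" and hm: "\<And>i. m < i \<Longrightarrow> h i = \<zero>"
    using lead by (auto simp: unit_end_coeffs_def)
  define n where "n = Max (laurent_supp R x)"
  have ne: "laurent_supp R x \<noteq> {}"
    using \<open>x \<noteq> \<zero>\<^bsub>laurent R\<^esub>\<close> by (auto simp: laurent_supp_def)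
  then have xn: "x n \<noteq> \<zero>"
    using Max_in[OF cl(4) ne] by (simp add: n_def laurent_supp_def)
  have above: "x i = \<zero>" if "n < i" for i
    using that Max_ge[OF cl(4), of i] by (force simp: n_def laurent_supp_def)
  \<comment> \<open>over the zero ring \<open>m\<close> is not in the support\<close>
  let ?A = "insert m (laurent_supp R h)"
  have "\<zero> = (h \<otimes>\<^bsub>laurent R\<^esub> x) (m + n)"
    by (simp add: eq)
  also have "\<dots> = (\<Oplus>i\<in>?A. h i \<otimes> x (m + n - i))"
    by (rule laurent_mult_eq[OF h x]) auto
  also have "\<dots> = (\<Oplus>i\<in>?A. if m = i then h i \<otimes> x (m + n - i) else \<zero>)"
  proof (rule finsum_cong')
    fix i
    show "h i \<otimes> x (m + n - i) = (if m = i then h i \<otimes> x (m + n - i) else \<zero>)"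
      using hm[of i] above[of "m + n - i"] by (cases m i rule: linorder_cases) auto
  qed auto
  also have "\<dots> = h m \<otimes> x n"
    by (subst add.finprod_singleton) auto
  finally have "h m \<otimes> x n = \<zero>" ..
  then have "h m \<otimes> x n = h m \<otimes> \<zero>"
    by (simp only: cl r_null)
  then have "x n = \<zero>"
    using Units_l_cancel[OF m cl(3) zero_closed] by blast
  then show False
    using xn by contradiction
qed

section \<open>Quandle isomorphisms\<close>

text \<open>
  A quandle structure is transported along a bijection that respects the operations, so that
  the target need not be known to be a quandle in advance.
\<close>

lemma quandle_isomorphic_image:
  assumes Q: "quandle Q"
    and img: "f ` carrier Q = carrier Q'" and inj: "inj_on f (carrier Q)"
    and hom: "\<And>a b. \<lbrakk>a \<in> carrier Q; b \<in> carrier Q\<rbrakk> \<Longrightarrow> f (a \<star>\<^bsub>Q\<^esub> b) = f a \<star>\<^bsub>Q'\<^esub> f b"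
  shows "Q \<cong>\<^sub>Q Q'"
proof -
  interpret quandle Q by fact
  have lift: "\<exists>x\<in>carrier Q. a = f x" if "a \<in> carrier Q'" for a
    using that img by auto
  have mem: "f x \<in> carrier Q'" if "x \<in> carrier Q" for x
    using that img by auto
  have "quandle Q'"
  proof
    fix a b assume "a \<in> carrier Q'" "b \<in> carrier Q'"
    then obtain x y where xy: "x \<in> carrier Q" "y \<in> carrier Q" "a = f x" "b = f y"
      using lift by blast
    show "a \<star>\<^bsub>Q'\<^esub> b \<in> carrier Q'"
      using xy mem[of "x \<star>\<^bsub>Q\<^esub> y"] closed by (simp add: hom)
    obtain z where z: "z \<in> carrier Q" "x = z \<star>\<^bsub>Q\<^esub> y"
      "\<And>w. \<lbrakk>w \<in> carrier Q; x = w \<star>\<^bsub>Q\<^esub> y\<rbrakk> \<Longrightarrow> w = z"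
      using right_div[OF xy(1,2)] by blast
    show "\<exists>!c. c \<in> carrier Q' \<and> a = c \<star>\<^bsub>Q'\<^esub> b"
    proof (rule ex1I[of _ "f z"])
      show "f z \<in> carrier Q' \<and> a = f z \<star>\<^bsub>Q'\<^esub> b"
        using z(1,2) xy mem by (metis hom)
    next
      fix c assume c: "c \<in> carrier Q' \<and> a = c \<star>\<^bsub>Q'\<^esub> b"
      then obtain w where w: "w \<in> carrier Q" "c = f w"
        using lift by blast
      then have "f x = f (w \<star>\<^bsub>Q\<^esub> y)"
        using c xy by (simp add: hom)
      then have "x = w \<star>\<^bsub>Q\<^esub> y"
        using inj xy w closed by (simp add: inj_on_eq_iff)
      then show "c = f z"
        using z(3) w by blast
    qed
  next
    fix a assume "a \<in> carrier Q'"
    then show "a \<star>\<^bsub>Q'\<^esub> a = a"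
      using lift hom idem by metis
  next
    fix a b c assume "a \<in> carrier Q'" "b \<in> carrier Q'" "c \<in> carrier Q'"
    then obtain x y z where *: "x \<in> carrier Q" "y \<in> carrier Q" "z \<in> carrier Q"
      "a = f x" "b = f y" "c = f z"
      using lift by metis
    then show "a \<star>\<^bsub>Q'\<^esub> b \<star>\<^bsub>Q'\<^esub> c = a \<star>\<^bsub>Q'\<^esub> c \<star>\<^bsub>Q'\<^esub> (b \<star>\<^bsub>Q'\<^esub> c)"
      using right_distrib[of x y z] by (simp add: closed flip: hom)
  qed
  moreover have "f \<in> quandle_iso Q Q'"
    using img inj hom by (auto simp: quandle_iso_def bij_betw_def)
  ultimately show ?thesis
    using Q by (auto simp: quandle_isomorphic_def)
qed

section \<open>Alexander quandles of quotient rings\<close>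

text \<open>
  The quotient \<open>R/I\<close> with scalars from \<open>\<Lambda>\<close>, each acting as multiplication by its image under \<open>\<rho>\<close>.
  It is a \<open>\<Lambda>\<close>-module if \<open>\<rho>\<close> is a ring homomorphism.
\<close>

definition quot_module ::
  "('a, 'm) ring_scheme \<Rightarrow> ((int \<Rightarrow> int) \<Rightarrow> 'a) \<Rightarrow> 'a set \<Rightarrow> (int \<Rightarrow> int, 'a set) module" where
  "quot_module R \<rho> I =
    \<lparr>carrier = carrier (R Quot I), monoid.mult = monoid.mult (R Quot I), one = one (R Quot I),
     ring.zero = ring.zero (R Quot I), add = add (R Quot I),
     smult = (\<lambda>f a. (I +>\<^bsub>R\<^esub> \<rho> f) \<otimes>\<^bsub>R Quot I\<^esub> a)\<rparr>"

text \<open>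
  A commutative ring over which Alexander quandles can be formed. Only the images of \<open>T\<close> and
  \<open>1 - T\<close> under \<open>\<rho>\<close> enter the quandle operation, so no more is required of \<open>\<rho>\<close>.
\<close>

locale alexander_ring = cring R for R :: "('a, 'm) ring_scheme" (structure) +
  fixes \<rho> :: "(int \<Rightarrow> int) \<Rightarrow> 'a" and t :: 'a
  assumes rho_T: "\<rho> (laurent_T \<Z>) = t"
    and rho_one_minus_T: "\<rho> (\<one>\<^bsub>\<Lambda>\<^esub> \<ominus>\<^bsub>\<Lambda>\<^esub> laurent_T \<Z>) = \<one> \<ominus> t"
    and t_unit: "t \<in> Units R"
begin

text \<open>Ring identities by which the cocycle computations telescope.\<close>

lemma telescope:
  assumes "a \<in> carrier R" "b \<in> carrier R" "u \<in> carrier R" "u' \<in> carrier R"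
    "v \<in> carrier R" "v' \<in> carrier R" "d \<in> carrier R"
  shows "a \<otimes> (u \<ominus> u') \<oplus> b \<otimes> (v \<ominus> v') \<oplus> (a \<otimes> u' \<oplus> b \<otimes> v' \<ominus> d) = a \<otimes> u \<oplus> b \<otimes> v \<ominus> d"
  using assms by algebra

lemma telescope_left:
  assumes "a \<in> carrier R" "b \<in> carrier R" "u \<in> carrier R" "u' \<in> carrier R"
    "v \<in> carrier R" "d \<in> carrier R"
  shows "a \<otimes> (u \<ominus> u') \<oplus> (a \<otimes> u' \<oplus> b \<otimes> v \<ominus> d) = a \<otimes> u \<oplus> b \<otimes> v \<ominus> d"
  using assms by algebra

lemma scale_combination:
  assumes "g \<in> carrier R" "a \<in> carrier R" "b \<in> carrier R"
    "u \<in> carrier R" "v \<in> carrier R" "w \<in> carrier R"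
  shows "g \<otimes> (a \<otimes> u \<oplus> b \<otimes> v \<oplus> w) = a \<otimes> (g \<otimes> u) \<oplus> b \<otimes> (g \<otimes> v) \<oplus> g \<otimes> w"
  using assms by algebra

text \<open>The Alexander quandle operation of \<open>R\<close> itself, of which those of its quotients are the images.\<close>

definition alex_op :: "'a \<Rightarrow> 'a \<Rightarrow> 'a" (infixl \<open>\<triangleright>\<close> 70) where
  "x \<triangleright> y = t \<otimes> x \<oplus> (\<one> \<ominus> t) \<otimes> y"

abbreviation "quot I \<equiv> quot_module R \<rho> I"

lemma t_closed [simp, intro]: "t \<in> carrier R"
  using t_unit by (rule Units_closed)

lemma alex_op_closed [simp, intro]:
  "\<lbrakk>x \<in> carrier R; y \<in> carrier R\<rbrakk> \<Longrightarrow> x \<triangleright> y \<in> carrier R"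
  by (simp add: alex_op_def)

lemma alex_op_idem: "x \<in> carrier R \<Longrightarrow> x \<triangleright> x = x"
  unfolding alex_op_def using t_closed by algebra

lemma alex_op_distrib:
  "\<lbrakk>x \<in> carrier R; y \<in> carrier R; z \<in> carrier R\<rbrakk>
    \<Longrightarrow> x \<triangleright> y \<triangleright> z = x \<triangleright> z \<triangleright> (y \<triangleright> z)"
  unfolding alex_op_def using t_closed by algebra

lemma carrier_quot: "carrier (quot I) = (\<lambda>x. I +> x) ` carrier R"
  by (auto simp: quot_module_def FactRing_simps)

lemma quot_closed [simp, intro]: "x \<in> carrier R \<Longrightarrow> I +> x \<in> carrier (quot I)"
  by (simp add: carrier_quot)

lemma quot_coset:
  assumes "ideal I R" "x \<in> carrier R" "y \<in> carrier R"
  shows "(I +> x) \<oplus>\<^bsub>quot I\<^esub> (I +> y) = I +> (x \<oplus> y)"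
    and "T_smult (quot I) (I +> x) = I +> (t \<otimes> x)"
    and "one_minus_T_smult (quot I) (I +> x) = I +> ((\<one> \<ominus> t) \<otimes> x)"
  using assms
  by (simp_all add: quot_module_def FactRing_simps ideal.a_rcos_sum ideal.rcoset_mult_add
      rho_T rho_one_minus_T)

lemma alexander_quot_carrier: "carrier (alexander_quandle (quot I)) = (\<lambda>x. I +> x) ` carrier R"
  by (simp add: alexander_quandle_def carrier_quot)

lemma alexander_quot_op:
  assumes "ideal I R" "x \<in> carrier R" "y \<in> carrier R"
  shows "(I +> x) \<star>\<^bsub>alexander_quandle (quot I)\<^esub> (I +> y) = I +> (x \<triangleright> y)"
  using assms by (simp add: alexander_quandle_def quot_coset alex_op_def)

lemma coset_eq_iff:
  assumes "ideal I R" "x \<in> carrier R" "y \<in> carrier R"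
  shows "I +> x = I +> y \<longleftrightarrow> x \<ominus> y \<in> I"
  using quotient_eq_iff_same_a_r_cos[OF assms] by simp

lemma quandle_alexander_quot:
  assumes I: "ideal I R"
  shows "quandle (alexander_quandle (quot I))" (is "quandle ?Q")
proof
  fix a b assume "a \<in> carrier ?Q" "b \<in> carrier ?Q"
  then obtain x y where xy [simp]: "x \<in> carrier R" "y \<in> carrier R" "a = I +> x" "b = I +> y"
    by (auto simp: alexander_quot_carrier)
  show "a \<star>\<^bsub>?Q\<^esub> b \<in> carrier ?Q"
    by (auto simp: alexander_quot_op[OF I] alexander_quot_carrier)
  have tinv [simp]: "inv t \<in> carrier R" and tt: "inv t \<otimes> t = \<one>"
    using t_unit by auto
  \<comment> \<open>the unique solution of \<open>z \<triangleright> y = x\<close>\<close>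
  define z where "z = inv t \<otimes> (x \<ominus> (\<one> \<ominus> t) \<otimes> y)"
  have z [simp]: "z \<in> carrier R" by (simp add: z_def)
  have "t \<otimes> z = x \<ominus> (\<one> \<ominus> t) \<otimes> y"
    using t_unit by (simp add: z_def flip: m_assoc)
  then have zy: "z \<triangleright> y = x"
    unfolding alex_op_def using xy(1,2) t_closed by algebra
  show "\<exists>!c. c \<in> carrier ?Q \<and> a = c \<star>\<^bsub>?Q\<^esub> b"
  proof (rule ex1I[of _ "I +> z"])
    show "I +> z \<in> carrier ?Q \<and> a = (I +> z) \<star>\<^bsub>?Q\<^esub> b"
      by (auto simp: alexander_quot_op[OF I] alexander_quot_carrier zy)
  next
    fix c assume c: "c \<in> carrier ?Q \<and> a = c \<star>\<^bsub>?Q\<^esub> b"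
    then obtain w where w [simp]: "w \<in> carrier R" "c = I +> w"
      by (auto simp: alexander_quot_carrier)
    have "I +> (w \<triangleright> y) = I +> (z \<triangleright> y)"
      using c zy by (auto simp: alexander_quot_op[OF I])
    then have "(w \<triangleright> y) \<ominus> (z \<triangleright> y) \<in> I"
      by (simp add: coset_eq_iff[OF I])
    moreover have "(w \<triangleright> y) \<ominus> (z \<triangleright> y) = t \<otimes> (w \<ominus> z)"
      unfolding alex_op_def using xy(1,2) w(1) z t_closed by algebra
    ultimately have "inv t \<otimes> (t \<otimes> (w \<ominus> z)) \<in> I"
      using I ideal.I_l_closed tinv by metis
    then have "w \<ominus> z \<in> I"
      using tt by (simp flip: m_assoc)
    then show "c = I +> z"
      by (simp add: coset_eq_iff[OF I])
  qed
next
  fix a assume "a \<in> carrier ?Q"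
  then obtain x where x [simp]: "x \<in> carrier R" "a = I +> x"
    by (auto simp: alexander_quot_carrier)
  show "a \<star>\<^bsub>?Q\<^esub> a = a"
    by (simp add: alexander_quot_op[OF I] alex_op_idem)
next
  fix a b c assume "a \<in> carrier ?Q" "b \<in> carrier ?Q" "c \<in> carrier ?Q"
  then obtain x y z where xyz [simp]: "x \<in> carrier R" "y \<in> carrier R" "z \<in> carrier R"
    "a = I +> x" "b = I +> y" "c = I +> z"
    by (auto simp: alexander_quot_carrier)
  show "a \<star>\<^bsub>?Q\<^esub> b \<star>\<^bsub>?Q\<^esub> c = a \<star>\<^bsub>?Q\<^esub> c \<star>\<^bsub>?Q\<^esub> (b \<star>\<^bsub>?Q\<^esub> c)"
    by (simp add: alexander_quot_op[OF I] alex_op_distrib[of x y z])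
qed

text \<open>First isomorphism theorem for the Alexander quandle of \<open>R\<close>.\<close>

lemma alexander_quot_isomorphic:
  assumes I: "ideal I R"
    and surj: "G ` carrier R = carrier Q"
    and ker: "\<And>x y. \<lbrakk>x \<in> carrier R; y \<in> carrier R\<rbrakk> \<Longrightarrow> G x = G y \<longleftrightarrow> x \<ominus> y \<in> I"
    and hom: "\<And>x y. \<lbrakk>x \<in> carrier R; y \<in> carrier R\<rbrakk> \<Longrightarrow> G (x \<triangleright> y) = G x \<star>\<^bsub>Q\<^esub> G y"
  shows "alexander_quandle (quot I) \<cong>\<^sub>Q Q"
proof -
  let ?f = "\<lambda>c. G (SOME x. x \<in> carrier R \<and> I +> x = c)"
  have f: "?f (I +> x) = G x" if x: "x \<in> carrier R" for x
  proof -
    have "(SOME y. y \<in> carrier R \<and> I +> y = I +> x) \<in> carrier R \<and>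
        I +> (SOME y. y \<in> carrier R \<and> I +> y = I +> x) = I +> x"
      by (rule someI[of _ x]) (simp add: x)
    then show ?thesis
      using x ker coset_eq_iff[OF I] by blast
  qed
  show ?thesis
  proof (rule quandle_isomorphic_image[OF quandle_alexander_quot[OF I]])
    show "?f ` carrier (alexander_quandle (quot I)) = carrier Q"
      unfolding surj[symmetric] by (simp add: alexander_quot_carrier image_image f cong: image_cong)
    show "inj_on ?f (carrier (alexander_quandle (quot I)))"
      by (auto simp: inj_on_def alexander_quot_carrier f ker coset_eq_iff[OF I])
  qed (auto simp: alexander_quot_carrier alexander_quot_op[OF I] f hom)
qed

section \<open>The Chinese remainder theorem\<close>

text \<open>\<open>(g) + (h) = R\<close>, expressed by a Bezout identity.\<close>

definition comaximal :: "'a \<Rightarrow> 'a \<Rightarrow> bool" where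
  "comaximal g h \<longleftrightarrow> (\<exists>a\<in>carrier R. \<exists>b\<in>carrier R. a \<otimes> g \<oplus> b \<otimes> h = \<one>)"

lemma comaximalI:
  assumes "PIdl g <+> PIdl h = carrier R"
  shows "comaximal g h"
proof -
  have "\<one> \<in> PIdl g <+> PIdl h" using assms by simp
  then obtain a b where "a \<in> carrier R" "b \<in> carrier R" "\<one> = a \<otimes> g \<oplus> b \<otimes> h"
    by (auto simp: set_add_def' cgenideal_def)
  then show ?thesis
    unfolding comaximal_def by metis
qed

lemma comaximal_sym:
  assumes "comaximal g h" "g \<in> carrier R" "h \<in> carrier R"
  shows "comaximal h g"
  using assms unfolding comaximal_def by (metis a_comm m_closed)

lemma comaximal_mult:
  assumes "comaximal g h" "comaximal g h'" and cl: "g \<in> carrier R" "h \<in> carrier R" "h' \<in> carrier R"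
  shows "comaximal g (h \<otimes> h')"
proof -
  obtain a b where ab: "a \<in> carrier R" "b \<in> carrier R" "a \<otimes> g \<oplus> b \<otimes> h = \<one>"
    using assms(1) by (auto simp: comaximal_def)
  obtain c d where cd: "c \<in> carrier R" "d \<in> carrier R" "c \<otimes> g \<oplus> d \<otimes> h' = \<one>"
    using assms(2) by (auto simp: comaximal_def)
  have "(a \<oplus> b \<otimes> h \<otimes> c) \<otimes> g \<oplus> (b \<otimes> d) \<otimes> (h \<otimes> h')
      = a \<otimes> g \<oplus> b \<otimes> h \<otimes> (c \<otimes> g \<oplus> d \<otimes> h')"
    using ab(1,2) cd(1,2) cl by algebra
  also have "\<dots> = \<one>"
    using ab cl by (simp add: cd)
  finally show ?thesis
    using ab cd cl unfolding comaximal_def by blast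
qed

lemma comaximal_one: "g \<in> carrier R \<Longrightarrow> comaximal g \<one>"
  unfolding comaximal_def by (rule bexI[of _ \<zero>], rule bexI[of _ \<one>]) auto

lemma comaximal_pow:
  assumes "comaximal g h" "g \<in> carrier R" "h \<in> carrier R"
  shows "comaximal g (h [^] (n::nat))"
  by (induction n) (use assms in \<open>auto intro: comaximal_one comaximal_mult\<close>)

lemma comaximal_finprod:
  assumes "finite J" "g \<in> carrier R" "\<And>j. j \<in> J \<Longrightarrow> h j \<in> carrier R"
    and "\<And>j. j \<in> J \<Longrightarrow> comaximal g (h j)"
  shows "comaximal g (finprod R h J)"
  using assms
proof (induction J rule: finite_induct)
  case (insert j J)
  then have "comaximal g (h j \<otimes> finprod R h J)"
    by (intro comaximal_mult) auto
  then show ?case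
    using insert by (subst finprod_insert) auto
qed (simp add: comaximal_one)

lemma mem_PIdl_iff: "x \<in> PIdl g \<longleftrightarrow> (\<exists>a\<in>carrier R. x = a \<otimes> g)"
  by (auto simp: cgenideal_def)

lemma comaximal_mem_PIdl_mult_iff:
  assumes co: "comaximal g h" and cl: "g \<in> carrier R" "h \<in> carrier R" "x \<in> carrier R"
  shows "x \<in> PIdl (g \<otimes> h) \<longleftrightarrow> x \<in> PIdl g \<and> x \<in> PIdl h"
proof
  assume "x \<in> PIdl (g \<otimes> h)"
  then obtain c where c: "c \<in> carrier R" "x = c \<otimes> (g \<otimes> h)"
    by (auto simp: mem_PIdl_iff)
  have "x = (c \<otimes> h) \<otimes> g" "x = (c \<otimes> g) \<otimes> h"
    unfolding c(2) using c(1) cl(1,2) by algebra+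
  then show "x \<in> PIdl g \<and> x \<in> PIdl h"
    using c(1) cl unfolding mem_PIdl_iff by blast
next
  assume "x \<in> PIdl g \<and> x \<in> PIdl h"
  then obtain c d where cd: "c \<in> carrier R" "d \<in> carrier R" "x = c \<otimes> g" "x = d \<otimes> h"
    by (auto simp: mem_PIdl_iff)
  obtain a b where ab: "a \<in> carrier R" "b \<in> carrier R" "a \<otimes> g \<oplus> b \<otimes> h = \<one>"
    using co by (auto simp: comaximal_def)
  have "x = (a \<otimes> g \<oplus> b \<otimes> h) \<otimes> x"
    by (simp add: ab cl)
  also have "\<dots> = (a \<otimes> g) \<otimes> x \<oplus> (b \<otimes> h) \<otimes> x"
    by (rule l_distr) (use ab cl in auto)
  also have "\<dots> = (a \<otimes> g) \<otimes> (d \<otimes> h) \<oplus> (b \<otimes> h) \<otimes> (c \<otimes> g)"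
    using cd(3,4) by simp
  also have "\<dots> = (a \<otimes> d \<oplus> b \<otimes> c) \<otimes> (g \<otimes> h)"
    using ab(1,2) cd(1,2) cl(1,2) by algebra
  finally show "x \<in> PIdl (g \<otimes> h)"
    using ab cd unfolding mem_PIdl_iff by blast
qed

lemma pairwise_comaximal_mem_finprod_iff:
  assumes "finite J" "\<And>j. j \<in> J \<Longrightarrow> g j \<in> carrier R"
    and "\<And>i j. \<lbrakk>i \<in> J; j \<in> J; i \<noteq> j\<rbrakk> \<Longrightarrow> comaximal (g i) (g j)"
    and x: "x \<in> carrier R"
  shows "x \<in> PIdl (finprod R g J) \<longleftrightarrow> (\<forall>j\<in>J. x \<in> PIdl (g j))"
  using assms(1-3)
proof (induction J rule: finite_induct)
  case empty
  then show ?case using x by (force simp: mem_PIdl_iff)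
next
  case (insert j J)
  have "comaximal (g j) (finprod R g J)"
    using insert by (intro comaximal_finprod) auto
  then have "x \<in> PIdl (g j \<otimes> finprod R g J) \<longleftrightarrow> x \<in> PIdl (g j) \<and> x \<in> PIdl (finprod R g J)"
    using insert.prems x by (intro comaximal_mem_PIdl_mult_iff) auto
  then show ?case
    using insert by (subst finprod_insert) auto
qed

lemma pairwise_comaximal_simultaneous:
  assumes "finite J" "\<And>j. j \<in> J \<Longrightarrow> g j \<in> carrier R"
    and "\<And>i j. \<lbrakk>i \<in> J; j \<in> J; i \<noteq> j\<rbrakk> \<Longrightarrow> comaximal (g i) (g j)"
    and "\<And>j. j \<in> J \<Longrightarrow> c j \<in> carrier R"
  shows "\<exists>x\<in>carrier R. \<forall>j\<in>J. x \<ominus> c j \<in> PIdl (g j)"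
  using assms
proof (induction J rule: finite_induct)
  case (insert j J)
  let ?G = "finprod R g J"
  have cl [simp]: "g j \<in> carrier R" "c j \<in> carrier R" "?G \<in> carrier R"
    using insert.prems by auto
  obtain x where x [simp]: "x \<in> carrier R" and xJ: "\<And>i. i \<in> J \<Longrightarrow> x \<ominus> c i \<in> PIdl (g i)"
    using insert by auto
  have "comaximal (g j) ?G"
    using insert by (intro comaximal_finprod) auto
  then obtain a b where ab [simp]: "a \<in> carrier R" "b \<in> carrier R" and eq: "a \<otimes> g j \<oplus> b \<otimes> ?G = \<one>"
    by (auto simp: comaximal_def)
  \<comment> \<open>\<open>b \<otimes> G\<close> is 1 modulo \<open>g j\<close> and 0 modulo \<open>G\<close>, while \<open>a \<otimes> g j\<close> is 0 and 1 respectively\<close>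
  define y where "y = a \<otimes> g j \<otimes> x \<oplus> b \<otimes> ?G \<otimes> c j"
  have y [simp]: "y \<in> carrier R" by (simp add: y_def)
  have "y \<ominus> c j = y \<ominus> (a \<otimes> g j \<oplus> b \<otimes> ?G) \<otimes> c j"
    by (simp add: eq)
  also have "\<dots> = a \<otimes> (x \<ominus> c j) \<otimes> g j"
    unfolding y_def using cl x ab by algebra
  finally have yj: "y \<ominus> c j \<in> PIdl (g j)"
    by (auto simp: mem_PIdl_iff)
  have "y \<ominus> x = y \<ominus> (a \<otimes> g j \<oplus> b \<otimes> ?G) \<otimes> x"
    by (simp add: eq)
  also have "\<dots> = b \<otimes> (c j \<ominus> x) \<otimes> ?G"
    unfolding y_def using cl x ab by algebra
  finally have "y \<ominus> x \<in> PIdl ?G"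
    by (auto simp: mem_PIdl_iff)
  then have yx: "y \<ominus> x \<in> PIdl (g i)" if "i \<in> J" for i
    using pairwise_comaximal_mem_finprod_iff[of J g "y \<ominus> x"] insert that by auto
  have "y \<ominus> c i \<in> PIdl (g i)" if i: "i \<in> J" for i
  proof -
    have gi: "g i \<in> carrier R" and ci: "c i \<in> carrier R"
      using insert.prems i by auto
    have "y \<ominus> c i = (y \<ominus> x) \<oplus> (x \<ominus> c i)"
      using x y ci by algebra
    then show ?thesis
      using yx[OF i] xJ[OF i] cgenideal_ideal[OF gi]
      by (simp add: additive_subgroup.a_closed ideal.axioms(1))
  qed
  then show ?case
    using yj y by auto
qed auto

text \<open>The residue map \<open>x \<mapsto> (x mod g\<^sub>j)\<^sub>j\<close> is surjective with kernel generated by the product.\<close>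

theorem alexander_quot_finprod_isomorphic:
  assumes fin: "finite J" and g: "\<And>j. j \<in> J \<Longrightarrow> g j \<in> carrier R"
    and co: "\<And>i j. \<lbrakk>i \<in> J; j \<in> J; i \<noteq> j\<rbrakk> \<Longrightarrow> comaximal (g i) (g j)"
  shows "alexander_quandle (quot (PIdl (finprod R g J)))
    \<cong>\<^sub>Q quandle_prod J (\<lambda>j. alexander_quandle (quot (PIdl (g j))))" (is "_ \<cong>\<^sub>Q ?P")
proof (rule alexander_quot_isomorphic)
  let ?G = "\<lambda>x. \<lambda>j\<in>J. PIdl (g j) +> x"
  have id: "ideal (PIdl (g j)) R" if "j \<in> J" for j
    by (rule cgenideal_ideal[OF g[OF that]])
  have "finprod R g J \<in> carrier R"
    using g by auto
  then show "ideal (PIdl (finprod R g J)) R"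
    by (rule cgenideal_ideal)
  show "?G ` carrier R = carrier ?P"
  proof
    show "?G ` carrier R \<subseteq> carrier ?P"
      by (auto simp: quandle_prod_def alexander_quot_carrier)
    show "carrier ?P \<subseteq> ?G ` carrier R"
    proof
      fix F assume "F \<in> carrier ?P"
      then have F: "F \<in> (\<Pi>\<^sub>E j\<in>J. (\<lambda>x. PIdl (g j) +> x) ` carrier R)"
        by (simp add: quandle_prod_def alexander_quot_carrier)
      then have "\<forall>j\<in>J. \<exists>c\<in>carrier R. F j = PIdl (g j) +> c"
        by (auto simp: PiE_def Pi_def)
      then obtain c where c: "\<And>j. j \<in> J \<Longrightarrow> c j \<in> carrier R \<and> F j = PIdl (g j) +> c j"
        by metis
      have "\<exists>x\<in>carrier R. \<forall>j\<in>J. x \<ominus> c j \<in> PIdl (g j)"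
        by (rule pairwise_comaximal_simultaneous[OF fin g co]) (use c in simp_all)
      then obtain x where x: "x \<in> carrier R" "\<And>j. j \<in> J \<Longrightarrow> x \<ominus> c j \<in> PIdl (g j)"
        by auto
      have "F = ?G x"
      proof
        fix j show "F j = ?G x j"
          using F c[of j] x coset_eq_iff[OF id[of j] x(1), of "c j"] by (cases "j \<in> J") auto
      qed
      then show "F \<in> ?G ` carrier R"
        using x(1) by blast
    qed
  qed
next
  fix x y assume xy: "x \<in> carrier R" "y \<in> carrier R"
  have "(\<lambda>j\<in>J. PIdl (g j) +> x) = (\<lambda>j\<in>J. PIdl (g j) +> y)
      \<longleftrightarrow> (\<forall>j\<in>J. PIdl (g j) +> x = PIdl (g j) +> y)"
    by (metis (no_types, lifting) restrict_apply' restrict_ext)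
  also have "\<dots> \<longleftrightarrow> (\<forall>j\<in>J. x \<ominus> y \<in> PIdl (g j))"
    by (rule ball_cong[OF refl]) (rule coset_eq_iff[OF cgenideal_ideal[OF g] xy])
  also have "\<dots> \<longleftrightarrow> x \<ominus> y \<in> PIdl (finprod R g J)"
    using pairwise_comaximal_mem_finprod_iff[OF fin g co, where x = "x \<ominus> y"] xy by simp
  finally show "(\<lambda>j\<in>J. PIdl (g j) +> x) = (\<lambda>j\<in>J. PIdl (g j) +> y)
      \<longleftrightarrow> x \<ominus> y \<in> PIdl (finprod R g J)" .
  show "(\<lambda>j\<in>J. PIdl (g j) +> (x \<triangleright> y))
      = (\<lambda>j\<in>J. PIdl (g j) +> x) \<star>\<^bsub>?P\<^esub> (\<lambda>j\<in>J. PIdl (g j) +> y)"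
    unfolding quandle_prod_def
    by (simp, rule restrict_ext) (simp add: alexander_quot_op[OF cgenideal_ideal[OF g] xy])
qed

section \<open>Extensions of quotient rings\<close>

text \<open>A set-theoretic section of \<open>R \<rightarrow> R/I\<close>; in general not a homomorphism.\<close>

definition coset_rep :: "'a set \<Rightarrow> 'a" where
  "coset_rep c = (SOME x. x \<in> c)"

text \<open>The quotient \<open>y/g\<close>, for \<open>y\<close> divisible by the non-zero-divisor \<open>g\<close>.\<close>

definition exact_quotient :: "'a \<Rightarrow> 'a \<Rightarrow> 'a" where
  "exact_quotient g y = (SOME a. a \<in> carrier R \<and> g \<otimes> a = y)"

text \<open>
  The failure of the section \<open>coset_rep\<close> of \<open>R \<rightarrow> R/(g)\<close> to be a quandle homomorphism
  is divisible by \<open>g\<close>; dividing by \<open>g\<close> gives an \<open>R\<close>-valued cocycle.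
\<close>

definition section_cocycle :: "'a \<Rightarrow> 'a set \<Rightarrow> 'a set \<Rightarrow> 'a" where
  "section_cocycle g c d = exact_quotient g
    (coset_rep c \<triangleright> coset_rep d \<ominus> coset_rep (c \<star>\<^bsub>alexander_quandle (quot (PIdl g))\<^esub> d))"

lemma coset_rep:
  assumes I: "ideal I R" and c: "c \<in> carrier (quot I)"
  shows "coset_rep c \<in> carrier R" "I +> coset_rep c = c"
proof -
  obtain x where x: "x \<in> carrier R" "c = I +> x"
    using c by (auto simp: carrier_quot)
  interpret I: ideal I R by fact
  have "x \<in> c"
    using x I.a_rcos_self by simp
  then have "coset_rep c \<in> c"
    unfolding coset_rep_def by (rule someI)
  then have *: "coset_rep c \<in> I +> x"
    using x by simp
  then show "coset_rep c \<in> carrier R"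
    using I.a_elemrcos_carrier x(1) by metis
  show "I +> coset_rep c = c"
    by (rule trans[OF a_repr_independence[OF * x(1) I.a_subgroup, symmetric] x(2)[symmetric]])
qed

lemma exact_quotient:
  assumes "y \<in> PIdl g" "g \<in> carrier R"
  shows "exact_quotient g y \<in> carrier R" "g \<otimes> exact_quotient g y = y"
proof -
  obtain a where "a \<in> carrier R" "y = a \<otimes> g"
    using assms(1) by (auto simp: mem_PIdl_iff)
  then have "a \<in> carrier R \<and> g \<otimes> a = y"
    using m_comm[OF assms(2)] by simp
  then have "exact_quotient g y \<in> carrier R \<and> g \<otimes> exact_quotient g y = y"
    unfolding exact_quotient_def by (rule someI)
  then show "exact_quotient g y \<in> carrier R" "g \<otimes> exact_quotient g y = y"
    by auto
qed

context
  fixes g h :: 'a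
  assumes g: "g \<in> carrier R" and h: "h \<in> carrier R"
    and reg: "\<And>x. \<lbrakk>x \<in> carrier R; g \<otimes> x = \<zero>\<rbrakk> \<Longrightarrow> x = \<zero>"
begin

text \<open>The base and the fibre of the extension, and its cocycle.\<close>

abbreviation (input) "XQ \<equiv> alexander_quandle (quot (PIdl g))"
abbreviation (input) "AM \<equiv> quot (PIdl h)"
abbreviation (input) "\<phi> \<equiv> \<lambda>c d. PIdl h +> section_cocycle g c d"

lemma ideal_g: "ideal (PIdl g) R" and ideal_h: "ideal (PIdl h) R"
  using g h by (auto intro: cgenideal_ideal)

lemma regular_cancel:
  assumes "x \<in> carrier R" "y \<in> carrier R" "g \<otimes> x = g \<otimes> y"
  shows "x = y"
proof -
  have "g \<otimes> (x \<ominus> y) = g \<otimes> x \<ominus> g \<otimes> y"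
    using assms(1,2) g by algebra
  also have "\<dots> = \<zero>"
    using assms g by simp
  finally have "x \<ominus> y = \<zero>"
    using reg assms by simp
  then show ?thesis
    using assms r_right_minus_eq by simp
qed

lemma X_rep:
  assumes "c \<in> carrier XQ"
  shows "coset_rep c \<in> carrier R" "PIdl g +> coset_rep c = c"
  using assms coset_rep[OF ideal_g, of c] by (simp_all add: alexander_quot_carrier carrier_quot)

lemma X_closed: "\<lbrakk>c \<in> carrier XQ; d \<in> carrier XQ\<rbrakk> \<Longrightarrow> c \<star>\<^bsub>XQ\<^esub> d \<in> carrier XQ"
  by (rule quandle.closed[OF quandle_alexander_quot[OF ideal_g]])

lemma section_cocycle:
  assumes c: "c \<in> carrier XQ" and d: "d \<in> carrier XQ"
  shows "section_cocycle g c d \<in> carrier R"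
    and "g \<otimes> section_cocycle g c d = coset_rep c \<triangleright> coset_rep d \<ominus> coset_rep (c \<star>\<^bsub>XQ\<^esub> d)"
proof -
  have "PIdl g +> (coset_rep c \<triangleright> coset_rep d) = c \<star>\<^bsub>XQ\<^esub> d"
    using alexander_quot_op[OF ideal_g X_rep(1)[OF c] X_rep(1)[OF d]] X_rep(2) c d by simp
  also have "\<dots> = PIdl g +> coset_rep (c \<star>\<^bsub>XQ\<^esub> d)"
    using X_rep(2) X_closed c d by simp
  finally have "coset_rep c \<triangleright> coset_rep d \<ominus> coset_rep (c \<star>\<^bsub>XQ\<^esub> d) \<in> PIdl g"
    using coset_eq_iff[OF ideal_g] X_rep(1) X_closed c d by simp
  then show "section_cocycle g c d \<in> carrier R"
    and "g \<otimes> section_cocycle g c d = coset_rep c \<triangleright> coset_rep d \<ominus> coset_rep (c \<star>\<^bsub>XQ\<^esub> d)"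
    using exact_quotient[OF _ g] unfolding section_cocycle_def by blast+
qed

text \<open>
  The cocycle identity already holds in \<open>R\<close>: multiplied by \<open>g\<close>, both sides telescope to
  the same value.
\<close>

lemma section_cocycle_identity:
  assumes x: "x \<in> carrier XQ" and y: "y \<in> carrier XQ" and z: "z \<in> carrier XQ"
  shows "t \<otimes> section_cocycle g x y \<oplus> section_cocycle g (x \<star>\<^bsub>XQ\<^esub> y) z =
    t \<otimes> section_cocycle g x z \<oplus> (\<one> \<ominus> t) \<otimes> section_cocycle g y z
      \<oplus> section_cocycle g (x \<star>\<^bsub>XQ\<^esub> z) (y \<star>\<^bsub>XQ\<^esub> z)" (is "?l = ?r")
proof (rule regular_cancel)
  let ?c = "section_cocycle g" and ?s = coset_rep
  note cl = X_closed[OF x y] X_closed[OF x z] X_closed[OF y z]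
  note c = section_cocycle[OF x y] section_cocycle[OF x z] section_cocycle[OF y z]
    section_cocycle[OF cl(1) z] section_cocycle[OF cl(2,3)]
  have s: "?s x \<in> carrier R" "?s y \<in> carrier R" "?s z \<in> carrier R" "?s (x \<star>\<^bsub>XQ\<^esub> y) \<in> carrier R"
    "?s (x \<star>\<^bsub>XQ\<^esub> z) \<in> carrier R" "?s (y \<star>\<^bsub>XQ\<^esub> z) \<in> carrier R" "?s (x \<star>\<^bsub>XQ\<^esub> y \<star>\<^bsub>XQ\<^esub> z) \<in> carrier R"
    using x y z X_rep(1) X_closed by auto
  have distrib: "x \<star>\<^bsub>XQ\<^esub> z \<star>\<^bsub>XQ\<^esub> (y \<star>\<^bsub>XQ\<^esub> z) = x \<star>\<^bsub>XQ\<^esub> y \<star>\<^bsub>XQ\<^esub> z"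
    using quandle.right_distrib[OF quandle_alexander_quot[OF ideal_g] x y z] by simp
  have "g \<otimes> ?l = t \<otimes> (g \<otimes> ?c x y) \<oplus> g \<otimes> ?c (x \<star>\<^bsub>XQ\<^esub> y) z"
    using c(1,7) g t_closed by algebra
  also have "\<dots> = t \<otimes> (?s x \<triangleright> ?s y \<ominus> ?s (x \<star>\<^bsub>XQ\<^esub> y))
      \<oplus> (?s (x \<star>\<^bsub>XQ\<^esub> y) \<triangleright> ?s z \<ominus> ?s (x \<star>\<^bsub>XQ\<^esub> y \<star>\<^bsub>XQ\<^esub> z))"
    by (simp only: c)
  also have "\<dots> = ?s x \<triangleright> ?s y \<triangleright> ?s z \<ominus> ?s (x \<star>\<^bsub>XQ\<^esub> y \<star>\<^bsub>XQ\<^esub> z)"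
    unfolding alex_op_def by (rule telescope_left) (use s in auto)
  also have "\<dots> = ?s x \<triangleright> ?s z \<triangleright> (?s y \<triangleright> ?s z) \<ominus> ?s (x \<star>\<^bsub>XQ\<^esub> y \<star>\<^bsub>XQ\<^esub> z)"
    using s by (simp add: alex_op_distrib[of "?s x" "?s y" "?s z"])
  also have "\<dots> = t \<otimes> (?s x \<triangleright> ?s z \<ominus> ?s (x \<star>\<^bsub>XQ\<^esub> z))
      \<oplus> (\<one> \<ominus> t) \<otimes> (?s y \<triangleright> ?s z \<ominus> ?s (y \<star>\<^bsub>XQ\<^esub> z))
      \<oplus> (?s (x \<star>\<^bsub>XQ\<^esub> z) \<triangleright> ?s (y \<star>\<^bsub>XQ\<^esub> z) \<ominus> ?s (x \<star>\<^bsub>XQ\<^esub> y \<star>\<^bsub>XQ\<^esub> z))"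
    unfolding alex_op_def by (rule telescope[symmetric]) (use s in auto)
  also have "\<dots> = t \<otimes> (g \<otimes> ?c x z) \<oplus> (\<one> \<ominus> t) \<otimes> (g \<otimes> ?c y z)
      \<oplus> g \<otimes> ?c (x \<star>\<^bsub>XQ\<^esub> z) (y \<star>\<^bsub>XQ\<^esub> z)"
    by (simp only: c distrib)
  also have "\<dots> = g \<otimes> ?r"
    by (rule scale_combination[symmetric]) (use c g in auto)
  finally show "g \<otimes> ?l = g \<otimes> ?r" .
qed (use section_cocycle(1) X_closed x y z in auto)

lemma section_cocycle_diag:
  assumes x: "x \<in> carrier XQ"
  shows "section_cocycle g x x = \<zero>"
proof (rule regular_cancel)
  have "x \<star>\<^bsub>XQ\<^esub> x = x"
    by (rule quandle.idem[OF quandle_alexander_quot[OF ideal_g] x])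
  then have "g \<otimes> section_cocycle g x x = coset_rep x \<triangleright> coset_rep x \<ominus> coset_rep x"
    using section_cocycle(2)[OF x x] by simp
  also have "\<dots> = g \<otimes> \<zero>"
    using X_rep(1)[OF x] g by (simp add: alex_op_idem)
  finally show "g \<otimes> section_cocycle g x x = g \<otimes> \<zero>" .
qed (use section_cocycle(1)[OF x x] in auto)

lemma section_cocycle_in_Z_TQ2: "\<phi> \<in> Z_TQ2 XQ AM"
proof -
  have "PIdl h +> \<zero> = \<zero>\<^bsub>AM\<^esub>"
    using a_coset_add_zero ideal_h
    by (simp add: quot_module_def FactRing_def additive_subgroup.a_subset ideal.axioms(1))
  moreover have "T_smult AM (\<phi> x y) \<oplus>\<^bsub>AM\<^esub> \<phi> (x \<star>\<^bsub>XQ\<^esub> y) z =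
      T_smult AM (\<phi> x z) \<oplus>\<^bsub>AM\<^esub> one_minus_T_smult AM (\<phi> y z) \<oplus>\<^bsub>AM\<^esub> \<phi> (x \<star>\<^bsub>XQ\<^esub> z) (y \<star>\<^bsub>XQ\<^esub> z)"
    if "x \<in> carrier XQ" "y \<in> carrier XQ" "z \<in> carrier XQ" for x y z
  proof -
    have cl: "section_cocycle g x y \<in> carrier R" "section_cocycle g x z \<in> carrier R"
      "section_cocycle g y z \<in> carrier R" "section_cocycle g (x \<star>\<^bsub>XQ\<^esub> y) z \<in> carrier R"
      "section_cocycle g (x \<star>\<^bsub>XQ\<^esub> z) (y \<star>\<^bsub>XQ\<^esub> z) \<in> carrier R"
      using that section_cocycle(1) X_closed by auto
    show ?thesis
      unfolding quot_coset(2,3)[OF ideal_h cl(1) cl(1)] quot_coset(2,3)[OF ideal_h cl(2) cl(2)]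
        quot_coset(2,3)[OF ideal_h cl(3) cl(3)]
      by (simp add: quot_coset(1)[OF ideal_h] cl section_cocycle_identity[OF that])
  qed
  ultimately show ?thesis
    unfolding Z_TQ2_def using section_cocycle(1) section_cocycle_diag
    by (intro CollectI conjI ballI) (blast, simp only:, blast)
qed

text \<open>
  Every \<open>y \<in> R\<close> is uniquely \<open>g a + s\<close>, with \<open>s\<close> the chosen representative of the class of
  \<open>y\<close> modulo \<open>g\<close>. Sending \<open>y\<close> to the class of \<open>a\<close> modulo \<open>h\<close> and the class of \<open>y\<close> modulo
  \<open>g\<close> identifies \<open>R/(gh)\<close> with the extension.
\<close>

theorem alexander_quot_mult_isomorphic:
  "alexander_quandle (quot (PIdl (g \<otimes> h))) \<cong>\<^sub>Q alexander_extension XQ AM \<phi>" (is "_ \<cong>\<^sub>Q ?E")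
proof (rule alexander_quot_isomorphic)
  show "ideal (PIdl (g \<otimes> h)) R"
    using g h by (simp add: cgenideal_ideal)
  let ?s = "\<lambda>y. coset_rep (PIdl g +> y)"
  define q where "q y = exact_quotient g (y \<ominus> ?s y)" for y
  have clX [simp]: "PIdl g +> y \<in> carrier XQ" if "y \<in> carrier R" for y
    using that by (simp add: alexander_quot_carrier)
  have s [simp]: "?s y \<in> carrier R" if "y \<in> carrier R" for y
    using X_rep(1) that by simp
  have q: "q y \<in> carrier R" "g \<otimes> q y = y \<ominus> ?s y" if y: "y \<in> carrier R" for y
  proof -
    have "y \<ominus> ?s y \<in> PIdl g"
      using X_rep(2)[of "PIdl g +> y"] y coset_eq_iff[OF ideal_g, of y "?s y"] by simp
    then show "q y \<in> carrier R" "g \<otimes> q y = y \<ominus> ?s y"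
      unfolding q_def using exact_quotient[OF _ g] by blast+
  qed
  let ?G = "\<lambda>y. (PIdl h +> q y, PIdl g +> y)"
  show "?G ` carrier R = carrier ?E"
  proof
    show "?G ` carrier R \<subseteq> carrier ?E"
      using q(1) by (auto simp: alexander_extension_def alexander_quot_carrier)
    show "carrier ?E \<subseteq> ?G ` carrier R"
    proof
      fix P assume "P \<in> carrier ?E"
      then obtain a x where P: "a \<in> carrier R" "x \<in> carrier XQ" "P = (PIdl h +> a, x)"
        by (auto simp: alexander_extension_def carrier_quot)
      let ?y = "g \<otimes> a \<oplus> coset_rep x"
      note xr = X_rep[OF P(2)]
      have y: "?y \<in> carrier R"
        using P xr g by simp
      have "?y \<ominus> coset_rep x = a \<otimes> g"
        using P(1) xr(1) g by algebra
      then have "?y \<ominus> coset_rep x \<in> PIdl g"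
        using P(1) by (auto simp: mem_PIdl_iff)
      then have yx: "PIdl g +> ?y = x"
        using coset_eq_iff[OF ideal_g y xr(1)] xr(2) by simp
      have "g \<otimes> q ?y = ?y \<ominus> coset_rep x"
        using q(2)[OF y] yx by simp
      also have "\<dots> = g \<otimes> a"
        using P(1) xr(1) g by algebra
      finally have "q ?y = a"
        using regular_cancel q(1)[OF y] P(1) by blast
      then have "P = ?G ?y"
        using P yx by simp
      then show "P \<in> ?G ` carrier R"
        using y by blast
    qed
  qed
  fix x y assume x [simp]: "x \<in> carrier R" and y [simp]: "y \<in> carrier R"
  show "?G x = ?G y \<longleftrightarrow> x \<ominus> y \<in> PIdl (g \<otimes> h)"
  proof
    assume eq: "?G x = ?G y"
    then have "q x \<ominus> q y \<in> PIdl h"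
      using coset_eq_iff[OF ideal_h] q(1) by simp
    then obtain a where a: "a \<in> carrier R" "q x \<ominus> q y = a \<otimes> h"
      by (auto simp: mem_PIdl_iff)
    have "x \<ominus> y = (x \<ominus> ?s x) \<ominus> (y \<ominus> ?s x)"
      using x y s[OF x] by algebra
    also have "\<dots> = g \<otimes> q x \<ominus> g \<otimes> q y"
      using q(2)[OF x] q(2)[OF y] eq by simp
    also have "\<dots> = g \<otimes> (q x \<ominus> q y)"
      using q(1)[OF x] q(1)[OF y] g by algebra
    also have "\<dots> = a \<otimes> (g \<otimes> h)"
      unfolding a(2) using a(1) g h by algebra
    finally show "x \<ominus> y \<in> PIdl (g \<otimes> h)"
      using a(1) by (auto simp: mem_PIdl_iff)
  next
    assume "x \<ominus> y \<in> PIdl (g \<otimes> h)"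
    then obtain a where a: "a \<in> carrier R" "x \<ominus> y = a \<otimes> (g \<otimes> h)"
      by (auto simp: mem_PIdl_iff)
    have "x \<ominus> y = a \<otimes> h \<otimes> g"
      unfolding a(2) using a(1) g h by algebra
    then have "x \<ominus> y \<in> PIdl g"
      using a(1) h by (auto simp: mem_PIdl_iff)
    then have eq: "PIdl g +> x = PIdl g +> y"
      by (simp add: coset_eq_iff[OF ideal_g])
    have "g \<otimes> (q x \<ominus> q y) = g \<otimes> q x \<ominus> g \<otimes> q y"
      using q(1)[OF x] q(1)[OF y] g by algebra
    also have "\<dots> = (x \<ominus> ?s x) \<ominus> (y \<ominus> ?s x)"
      using q(2)[OF x] q(2)[OF y] eq by simp
    also have "\<dots> = x \<ominus> y"
      using x y s[OF x] by algebra
    also have "\<dots> = g \<otimes> (a \<otimes> h)"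
      unfolding a(2) using a(1) g h by algebra
    finally have "q x \<ominus> q y = a \<otimes> h"
      by (rule regular_cancel[rotated 2]) (use q(1) a(1) h in auto)
    then have "q x \<ominus> q y \<in> PIdl h"
      using a(1) by (auto simp: mem_PIdl_iff)
    then show "?G x = ?G y"
      using eq q(1) by (simp add: coset_eq_iff[OF ideal_h])
  qed
  let ?c = "section_cocycle g (PIdl g +> x) (PIdl g +> y)"
  have c: "?c \<in> carrier R"
    and gc: "g \<otimes> ?c = ?s x \<triangleright> ?s y \<ominus> ?s (x \<triangleright> y)"
    using section_cocycle[OF clX[OF x] clX[OF y]] by (auto simp: alexander_quot_op[OF ideal_g])
  have "q (x \<triangleright> y) = q x \<triangleright> q y \<oplus> ?c"
  proof (rule regular_cancel)
    have "g \<otimes> (q x \<triangleright> q y \<oplus> ?c) = (g \<otimes> q x) \<triangleright> (g \<otimes> q y) \<oplus> g \<otimes> ?c"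
      unfolding alex_op_def by (rule scale_combination) (use q(1) c g in auto)
    also have "\<dots> = (x \<ominus> ?s x) \<triangleright> (y \<ominus> ?s y) \<oplus> (?s x \<triangleright> ?s y \<ominus> ?s (x \<triangleright> y))"
      by (simp only: q(2)[OF x] q(2)[OF y] gc)
    also have "\<dots> = x \<triangleright> y \<ominus> ?s (x \<triangleright> y)"
      unfolding alex_op_def[of "x \<ominus> ?s x"] alex_op_def[of "?s x"] alex_op_def[of x]
      by (rule telescope) (use s[OF alex_op_closed[OF x y]] in \<open>auto simp: alex_op_def\<close>)
    finally show "g \<otimes> q (x \<triangleright> y) = g \<otimes> (q x \<triangleright> q y \<oplus> ?c)"
      using q(2)[of "x \<triangleright> y"] by simp
  qed (use q(1) c in auto)
  then show "?G (x \<triangleright> y) = ?G x \<star>\<^bsub>?E\<^esub> ?G y"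
    using q(1) c
    by (simp add: alexander_extension_def alexander_quot_op[OF ideal_g] alexander_quot_op[OF ideal_h]
        quot_coset[OF ideal_h])
qed

end

end

section \<open>Quotients of \<open>\<Lambda>\<^sub>p\<close>\<close>

lemma Lam_mod_cring: "cring (Lam_mod p)"
  unfolding Lam_mod_def by (rule cring.laurent_cring[OF ZFact_is_cring])

lemma reduce_hom:
  "ring_hom_cring \<Z> (ZFact (int p)) ((+>\<^bsub>\<Z>\<^esub>) (Idl\<^bsub>\<Z>\<^esub> {int p}))"
  unfolding ZFact_def by (rule ideal.rcos_ring_hom_cring[OF int.genideal_ideal int.is_cring]) simp

lemma Lam_reduce_closed:
  assumes f: "f \<in> carrier \<Lambda>"
  shows "Lam_reduce p f \<in> carrier (Lam_mod p)"
  unfolding Lam_mod_def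
proof (rule ring.laurent_carrierI[OF cring.axioms(1)[OF ZFact_is_cring]])
  show "Lam_reduce p f n \<in> carrier (ZFact (int p))" for n
    unfolding Lam_reduce_def by (rule ring_hom_closed[OF ring_hom_cring.homh[OF reduce_hom]]) simp
  show "finite (laurent_supp \<Z> f)"
    by (rule laurent_carrierD(2)[OF f])
  show "Lam_reduce p f n = \<zero>\<^bsub>ZFact (int p)\<^esub>" if "n \<notin> laurent_supp \<Z> f" for n
  proof -
    have "f n = \<zero>\<^bsub>\<Z>\<^esub>"
      using that unfolding laurent_supp_def by blast
    then show ?thesis
      by (simp only: Lam_reduce_def ring_hom_cring.hom_zero[OF reduce_hom])
  qed
qed

lemma Lam_reduce_minus:
  assumes g: "g \<in> carrier \<Lambda>"
  shows "Lam_reduce p (f \<ominus>\<^bsub>\<Lambda>\<^esub> g) = Lam_reduce p f \<ominus>\<^bsub>Lam_mod p\<^esub> Lam_reduce p g"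
proof
  fix n
  have mem: "m \<in> carrier \<Z>" for m
    by simp
  have "Lam_reduce p (f \<ominus>\<^bsub>\<Lambda>\<^esub> g) n =
      Idl\<^bsub>\<Z>\<^esub> {int p} +>\<^bsub>\<Z>\<^esub> (f n \<oplus>\<^bsub>\<Z>\<^esub> \<ominus>\<^bsub>\<Z>\<^esub> g n)"
    by (simp only: Lam_reduce_def a_minus_def laurent_add ring.laurent_a_inv[OF int.ring_axioms g])
  also have "\<dots> = Lam_reduce p f n \<oplus>\<^bsub>ZFact (int p)\<^esub>
      (Idl\<^bsub>\<Z>\<^esub> {int p} +>\<^bsub>\<Z>\<^esub> (\<ominus>\<^bsub>\<Z>\<^esub> g n))"
    unfolding Lam_reduce_def by (rule ring_hom_add[OF ring_hom_cring.homh[OF reduce_hom] mem mem])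
  also have "\<dots> = Lam_reduce p f n \<oplus>\<^bsub>ZFact (int p)\<^esub> \<ominus>\<^bsub>ZFact (int p)\<^esub> Lam_reduce p g n"
    unfolding Lam_reduce_def
    by (simp only: ring_hom_cring.hom_a_inv[OF reduce_hom mem])
  also have "\<dots> = (Lam_reduce p f \<ominus>\<^bsub>Lam_mod p\<^esub> Lam_reduce p g) n"
    using Lam_reduce_closed[OF g, of p]
    by (simp only: Lam_mod_def a_minus_def laurent_add
        ring.laurent_a_inv[OF cring.axioms(1)[OF ZFact_is_cring]])
  finally show "Lam_reduce p (f \<ominus>\<^bsub>\<Lambda>\<^esub> g) n = (Lam_reduce p f \<ominus>\<^bsub>Lam_mod p\<^esub> Lam_reduce p g) n" .
qed

lemma Lam_reduce_one: "Lam_reduce p \<one>\<^bsub>\<Lambda>\<^esub> = \<one>\<^bsub>Lam_mod p\<^esub>"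
  unfolding Lam_mod_def Lam_reduce_def laurent_one
  by (rule ext) (auto simp only: ring_hom_one[OF ring_hom_cring.homh[OF reduce_hom]] ring_hom_cring.hom_zero[OF reduce_hom] split: if_split)

lemma Lam_reduce_T: "Lam_reduce p (laurent_T \<Z>) = laurent_T (ZFact (int p))"
  unfolding Lam_reduce_def laurent_T_def
  by (rule ext) (auto simp only: ring_hom_one[OF ring_hom_cring.homh[OF reduce_hom]] ring_hom_cring.hom_zero[OF reduce_hom] split: if_split)

lemma alexander_ring_Lam_mod:
  "alexander_ring (Lam_mod p) (Lam_reduce p) (laurent_T (ZFact (int p)))"
proof -
  interpret L: cring "Lam_mod p" by (rule Lam_mod_cring)
  have T: "laurent_T (ZFact (int p)) \<in> Units (Lam_mod p)"
    unfolding Lam_mod_def by (rule cring.laurent_T_unit[OF ZFact_is_cring])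
  show ?thesis
  proof
    show "Lam_reduce p (\<one>\<^bsub>\<Lambda>\<^esub> \<ominus>\<^bsub>\<Lambda>\<^esub> laurent_T \<Z>) =
        \<one>\<^bsub>Lam_mod p\<^esub> \<ominus>\<^bsub>Lam_mod p\<^esub> laurent_T (ZFact (int p))"
      by (simp only: Lam_reduce_minus[OF int.laurent_T_closed] Lam_reduce_one Lam_reduce_T)
  qed (rule Lam_reduce_T T)+
qed

lemma Lam_quot_eq: "Lam_quot p h = quot_module (Lam_mod p) (Lam_reduce p) (PIdl\<^bsub>Lam_mod p\<^esub> h)"
  by (simp add: Lam_quot_def quot_module_def Let_def)

lemma unit_end_coeffs_pow_cancel:
  assumes h: "h \<in> carrier (Lam_mod p)" and lead: "unit_end_coeffs (ZFact (int p)) h"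
    and x: "x \<in> carrier (Lam_mod p)"
    and eq: "h [^]\<^bsub>Lam_mod p\<^esub> (n::nat) \<otimes>\<^bsub>Lam_mod p\<^esub> x = \<zero>\<^bsub>Lam_mod p\<^esub>"
  shows "x = \<zero>\<^bsub>Lam_mod p\<^esub>"
proof -
  interpret L: cring "Lam_mod p" by (rule Lam_mod_cring)
  note pow = L.nat_pow_closed[OF h]
  show ?thesis
    using eq
  proof (induction n)
    case 0
    then show ?case using x by simp
  next
    case (Suc n)
    have "h \<otimes>\<^bsub>Lam_mod p\<^esub> (h [^]\<^bsub>Lam_mod p\<^esub> n \<otimes>\<^bsub>Lam_mod p\<^esub> x) =
        h [^]\<^bsub>Lam_mod p\<^esub> Suc n \<otimes>\<^bsub>Lam_mod p\<^esub> x"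
      by (simp only: L.nat_pow_Suc L.m_comm[OF pow h] L.m_assoc[OF h pow x])
    also have "\<dots> = \<zero>\<^bsub>Lam_mod p\<^esub>"
      by (rule Suc.prems)
    finally have "h [^]\<^bsub>Lam_mod p\<^esub> n \<otimes>\<^bsub>Lam_mod p\<^esub> x = \<zero>\<^bsub>Lam_mod p\<^esub>"
      using cring.unit_end_coeffs_cancel[OF ZFact_is_cring _ lead] h L.m_closed[OF pow x]
      unfolding Lam_mod_def by blast
    then show ?case
      by (rule Suc.IH)
  qed
qed

theorem theorem5p11:
  fixes p k :: nat and e :: "nat \<Rightarrow> nat" and h :: "nat \<Rightarrow> int \<Rightarrow> int set"
  assumes "p > 0" and "k > 0"
    and "\<forall>j\<in>{1..k}. e j > 0"
    and "\<forall>j\<in>{1..k}. is_polynomial (ZFact (int p)) (h j)"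
    and "\<forall>j\<in>{1..k}. unit_end_coeffs (ZFact (int p)) (h j)"
    and "\<forall>i\<in>{1..k}. \<forall>j\<in>{1..k}. i \<noteq> j \<longrightarrow>
      PIdl\<^bsub>Lam_mod p\<^esub> (h i) <+>\<^bsub>Lam_mod p\<^esub> PIdl\<^bsub>Lam_mod p\<^esub> (h j) = carrier (Lam_mod p)"
  shows "alexander_quandle (Lam_quot p (\<Otimes>\<^bsub>Lam_mod p\<^esub>j\<in>{1..k}. h j [^]\<^bsub>Lam_mod p\<^esub> e j))
      \<cong>\<^sub>Q quandle_prod {1..k} (\<lambda>j. alexander_quandle (Lam_quot p (h j [^]\<^bsub>Lam_mod p\<^esub> e j)))
    \<and> (\<forall>j\<in>{1..k}. \<forall>d. 2 \<le> d \<and> d \<le> e j \<longrightarrow>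
        (\<exists>\<phi> \<in> Z_TQ2 (alexander_quandle (Lam_quot p (h j [^]\<^bsub>Lam_mod p\<^esub> (d - 1))))
                    (Lam_quot p (h j)).
          alexander_quandle (Lam_quot p (h j [^]\<^bsub>Lam_mod p\<^esub> d))
          \<cong>\<^sub>Q alexander_extension
               (alexander_quandle (Lam_quot p (h j [^]\<^bsub>Lam_mod p\<^esub> (d - 1))))
               (Lam_quot p (h j)) \<phi>))"
proof (intro conjI ballI allI impI)
  interpret alexander_ring "Lam_mod p" "Lam_reduce p" "laurent_T (ZFact (int p))"
    by (rule alexander_ring_Lam_mod)
  have h: "h j \<in> carrier (Lam_mod p)" if "j \<in> {1..k}" for j
    using assms(4) that by (simp add: is_polynomial_def Lam_mod_def)
  have co: "comaximal (h i) (h j)" if "i \<in> {1..k}" "j \<in> {1..k}" "i \<noteq> j" for i j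
    using assms(6) that by (intro comaximalI) blast
  have "comaximal (h i [^]\<^bsub>Lam_mod p\<^esub> e i) (h j [^]\<^bsub>Lam_mod p\<^esub> e j)"
    if "i \<in> {1..k}" "j \<in> {1..k}" "i \<noteq> j" for i j
  proof -
    have "comaximal (h j) (h i [^]\<^bsub>Lam_mod p\<^esub> e i)"
      by (rule comaximal_pow[OF co]) (use that h in auto)
    then have "comaximal (h i [^]\<^bsub>Lam_mod p\<^esub> e i) (h j)"
      by (rule comaximal_sym) (use that h in auto)
    then show ?thesis
      by (rule comaximal_pow) (use that h in auto)
  qed
  then show "alexander_quandle (Lam_quot p (\<Otimes>\<^bsub>Lam_mod p\<^esub>j\<in>{1..k}. h j [^]\<^bsub>Lam_mod p\<^esub> e j))
      \<cong>\<^sub>Q quandle_prod {1..k} (\<lambda>j. alexander_quandle (Lam_quot p (h j [^]\<^bsub>Lam_mod p\<^esub> e j)))"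
    unfolding Lam_quot_eq
    by (intro alexander_quot_finprod_isomorphic finite_atLeastAtMost nat_pow_closed h)
  fix j d
  assume j: "j \<in> {1..k}" and d: "2 \<le> d \<and> d \<le> e j"
  let ?g = "h j [^]\<^bsub>Lam_mod p\<^esub> (d - 1)"
  have g: "?g \<in> carrier (Lam_mod p)"
    using h[OF j] by (rule nat_pow_closed)
  have reg: "x = \<zero>\<^bsub>Lam_mod p\<^esub>"
    if "x \<in> carrier (Lam_mod p)" "?g \<otimes>\<^bsub>Lam_mod p\<^esub> x = \<zero>\<^bsub>Lam_mod p\<^esub>" for x
    by (rule unit_end_coeffs_pow_cancel[OF h[OF j] _ that]) (use assms(5) j in blast)
  have pow: "h j [^]\<^bsub>Lam_mod p\<^esub> d = ?g \<otimes>\<^bsub>Lam_mod p\<^esub> h j"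
    using d nat_pow_Suc[of "h j" "d - 1"] by simp
  show "\<exists>\<phi> \<in> Z_TQ2 (alexander_quandle (Lam_quot p ?g)) (Lam_quot p (h j)).
      alexander_quandle (Lam_quot p (h j [^]\<^bsub>Lam_mod p\<^esub> d))
      \<cong>\<^sub>Q alexander_extension (alexander_quandle (Lam_quot p ?g)) (Lam_quot p (h j)) \<phi>"
    unfolding Lam_quot_eq pow
  proof (rule bexI)
    show "alexander_quandle (quot (PIdl\<^bsub>Lam_mod p\<^esub> (?g \<otimes>\<^bsub>Lam_mod p\<^esub> h j))) \<cong>\<^sub>Q
        alexander_extension (alexander_quandle (quot (PIdl\<^bsub>Lam_mod p\<^esub> ?g)))
          (quot (PIdl\<^bsub>Lam_mod p\<^esub> (h j)))
          (\<lambda>c d. PIdl\<^bsub>Lam_mod p\<^esub> (h j) +>\<^bsub>Lam_mod p\<^esub> section_cocycle ?g c d)"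
      by (rule alexander_quot_mult_isomorphic[OF g h[OF j]]) (rule reg)
    show "(\<lambda>c d. PIdl\<^bsub>Lam_mod p\<^esub> (h j) +>\<^bsub>Lam_mod p\<^esub> section_cocycle ?g c d)
        \<in> Z_TQ2 (alexander_quandle (quot (PIdl\<^bsub>Lam_mod p\<^esub> ?g))) (quot (PIdl\<^bsub>Lam_mod p\<^esub> (h j)))"
      by (rule section_cocycle_in_Z_TQ2[OF g h[OF j]]) (rule reg)
  qed
qed

end
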